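(* Assume the ${\bf kOV}$ conjecture. Then reachability on factored graphs is not fixed parameter tractable. In particular, the reachability problem on a factored graph $G=f(G_1,\dots,G_m)$ of complexity $(n,k)$ requires $n^{\Omega(k^{1/3})}$ time.
   Context: All graphs are directed. For directed graphs $G,H$: the Cartesian product $G\,\square\,H$ has vertex set $V(G)\times V(H)$ and an edge $((v_1,u_1),(v_2,u_2))$ iff either $v_1=v_2$ and $(u_1,u_2)\in E(H)$, or $u_1=u_2$ and $(v_1,v_2)\in E(G)$; the tensor product $G\times H$ has vertex set $V(G)\times V(H)$ and an edge iff $(v_1,v_2)\in E(G)$ and $(u_1,u_2)\in E(H)$; the union $G\cup H$ has vertex set $V(G)\cup V(H)$ and edge set $E(G)\cup E(H)$. Vertices of products are flattened tuples, so products are associative. A factored graph $G=f(G_1,\dots,G_m)$ is given by a formula $f$ built from explicitly given input graphs using these operations and parentheses; it has complexity $(n,k)$ if $f$ uses $k-1$ operations and each input graph has at most $n$ vertices. The reachability problem: given a factored graph $G$ and vertices $s,t$ of $G$, decide whether there is a directed path from $s$ to $t$ in $G$. A problem on factored graphs is fixed parameter tractable if it can be solved on factored graphs of complexity $(n,k)$ in time $O(g(k)n^C)$ for some function $g$ and absolute constant $C$ independent of $k$. ${\bf kOV}$ problem: given $k$ sets $A_1,\dots,A_k$ of $n$ vectors in $\{0,1\}^d$, decide whether there exist $a_1\in A_1,\dots,a_k\in A_k$ with $a_1[\ell]\cdots a_k[\ell]=0$ for all $\ell\in[d]$. ${\bf kOV}$ conjecture: there is no algorithm solving ${\bf kOV}$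 in time $O(n^{k-\varepsilon}\,\mathrm{poly}(d))$ for any $\varepsilon>0$; in particular, for $d=\mathrm{poly}(\log n)$ any algorithm requires $n^{k-o(1)}$ time. *)

theory Defs
  imports
    "HOL-Analysis.Analysis"
    "HOL-Library.Log_Nat"
    "Graph_Theory.Pair_Digraph"
begin

section \<open>Model of computation\<close>

text \<open>
  Structured random access machine under the logarithmic cost criterion: every read, write and
  arithmetic operation is charged the bit lengths of its operands (including addresses) and of its
  result. It agrees with the word RAM with logarithmic word length up to polylogarithmic factors,
  which are immaterial for all time bounds below. Unit cost on unbounded integers is
  avoided because it would make polynomial time bounds unrealistically powerful.
\<close>

datatype binop = Plus | Minus | Times | Divide | Modulo | Less | Equal

datatype aexp =
    Const nat
  | Reg nat
  | Mem aexp  \<comment> \<open>indirect read of the memory cell whose address is the value of the argument\<close>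
  | Bin binop aexp aexp

datatype com =
    Skip
  | Assign nat aexp
  | Store aexp aexp  \<comment> \<open>address first, then the value to be written\<close>
  | Seq com com
  | Cond aexp com com
  | While aexp com

text \<open>A state consists of the registers and the memory.\<close>

type_synonym state = "(nat \<Rightarrow> nat) \<times> (nat \<Rightarrow> nat)"

fun binop_val :: "binop \<Rightarrow> nat \<Rightarrow> nat \<Rightarrow> nat" where
  "binop_val Plus x y = x + y"
| "binop_val Minus x y = x - y"
| "binop_val Times x y = x * y"
| "binop_val Divide x y = x div y"
| "binop_val Modulo x y = x mod y"
| "binop_val Less x y = (if x < y then 1 else 0)"
| "binop_val Equal x y = (if x = y then 1 else 0)"

fun aval :: "aexp \<Rightarrow> state \<Rightarrow> nat" where
  "aval (Const c) \<sigma> = c"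
| "aval (Reg r) \<sigma> = fst \<sigma> r"
| "aval (Mem a) \<sigma> = snd \<sigma> (aval a \<sigma>)"
| "aval (Bin f a b) \<sigma> = binop_val f (aval a \<sigma>) (aval b \<sigma>)"

definition nat_cost :: "nat \<Rightarrow> nat" where
  "nat_cost x = Suc (floorlog 2 x)"

fun acost :: "aexp \<Rightarrow> state \<Rightarrow> nat" where
  "acost (Const c) \<sigma> = nat_cost c"
| "acost (Reg r) \<sigma> = nat_cost (aval (Reg r) \<sigma>)"
| "acost (Mem a) \<sigma> = acost a \<sigma> + nat_cost (aval (Mem a) \<sigma>)"
| "acost (Bin f a b) \<sigma> = acost a \<sigma> + acost b \<sigma> + nat_cost (aval (Bin f a b) \<sigma>)"

text \<open>\<open>exec c \<sigma> t \<tau>\<close>: started in \<open>\<sigma>\<close>, the program \<open>c\<close> halts in \<open>\<tau>\<close> after time \<open>t\<close>.\<close>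

inductive exec :: "com \<Rightarrow> state \<Rightarrow> nat \<Rightarrow> state \<Rightarrow> bool" where
  Skip: "exec Skip \<sigma> 1 \<sigma>"
| Assign: "exec (Assign r a) \<sigma> (acost a \<sigma> + 1) ((fst \<sigma>)(r := aval a \<sigma>), snd \<sigma>)"
| Store: "exec (Store a b) \<sigma> (acost a \<sigma> + acost b \<sigma> + 1)
    (fst \<sigma>, (snd \<sigma>)(aval a \<sigma> := aval b \<sigma>))"
| Seq: "exec c\<^sub>1 \<sigma> t\<^sub>1 \<sigma>' \<Longrightarrow> exec c\<^sub>2 \<sigma>' t\<^sub>2 \<tau> \<Longrightarrow> exec (Seq c\<^sub>1 c\<^sub>2) \<sigma> (t\<^sub>1 + t\<^sub>2) \<tau>"
| CondTrue: "aval a \<sigma> \<noteq> 0 \<Longrightarrow> exec c\<^sub>1 \<sigma> t \<tau> \<Longrightarrow> exec (Cond a c\<^sub>1 c\<^sub>2) \<sigma> (acost a \<sigma> + 1 + t) \<tau>"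
| CondFalse: "aval a \<sigma> = 0 \<Longrightarrow> exec c\<^sub>2 \<sigma> t \<tau> \<Longrightarrow> exec (Cond a c\<^sub>1 c\<^sub>2) \<sigma> (acost a \<sigma> + 1 + t) \<tau>"
| WhileFalse: "aval a \<sigma> = 0 \<Longrightarrow> exec (While a c) \<sigma> (acost a \<sigma> + 1) \<sigma>"
| WhileTrue: "aval a \<sigma> \<noteq> 0 \<Longrightarrow> exec c \<sigma> t\<^sub>1 \<sigma>' \<Longrightarrow> exec (While a c) \<sigma>' t\<^sub>2 \<tau> \<Longrightarrow>
    exec (While a c) \<sigma> (acost a \<sigma> + 1 + t\<^sub>1 + t\<^sub>2) \<tau>"

inductive_cases exec_SkipE: "exec Skip \<sigma> t \<tau>"
inductive_cases exec_AssignE: "exec (Assign r a) \<sigma> t \<tau>"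
inductive_cases exec_StoreE: "exec (Store a b) \<sigma> t \<tau>"
inductive_cases exec_SeqE: "exec (Seq c\<^sub>1 c\<^sub>2) \<sigma> t \<tau>"
inductive_cases exec_CondE: "exec (Cond a c\<^sub>1 c\<^sub>2) \<sigma> t \<tau>"
inductive_cases exec_WhileE: "exec (While a c) \<sigma> t \<tau>"

lemma exec_deterministic:
  assumes "exec c \<sigma> t \<tau>" and "exec c \<sigma> t' \<tau>'"
  shows "t' = t \<and> \<tau>' = \<tau>"
  using assms
proof (induction arbitrary: t' \<tau>' rule: exec.induct)
  case (Seq c\<^sub>1 \<sigma> t\<^sub>1 \<sigma>' c\<^sub>2 t\<^sub>2 \<tau>)
  from Seq.prems obtain u\<^sub>1 \<rho> u\<^sub>2
    where *: "t' = u\<^sub>1 + u\<^sub>2" "exec c\<^sub>1 \<sigma> u\<^sub>1 \<rho>" "exec c\<^sub>2 \<rho> u\<^sub>2 \<tau>'"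
    by (rule exec_SeqE)
  from Seq.IH(1)[OF *(2)] have "u\<^sub>1 = t\<^sub>1" "\<rho> = \<sigma>'" by (rule conjunct1, rule conjunct2)
  with Seq.IH(2)[of u\<^sub>2 \<tau>'] * show ?case by blast
next
  case (CondTrue a \<sigma> c\<^sub>1 t \<tau> c\<^sub>2)
  from CondTrue.prems obtain u where *: "t' = Suc (acost a \<sigma> + u)" "exec c\<^sub>1 \<sigma> u \<tau>'"
    by (rule exec_CondE) (simp_all add: CondTrue.hyps)
  from CondTrue.IH[OF *(2)] *(1) show ?case by simp
next
  case (CondFalse a \<sigma> c\<^sub>2 t \<tau> c\<^sub>1)
  from CondFalse.prems obtain u where *: "t' = Suc (acost a \<sigma> + u)" "exec c\<^sub>2 \<sigma> u \<tau>'"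
    by (rule exec_CondE) (simp_all add: CondFalse.hyps)
  from CondFalse.IH[OF *(2)] *(1) show ?case by simp
next
  case (WhileFalse a \<sigma> c)
  from WhileFalse.prems show ?case by (rule exec_WhileE) (simp_all add: WhileFalse.hyps)
next
  case (WhileTrue a \<sigma> c t\<^sub>1 \<sigma>' t\<^sub>2 \<tau>)
  from WhileTrue.prems obtain u\<^sub>1 \<rho> u\<^sub>2
    where *: "t' = Suc (acost a \<sigma> + u\<^sub>1 + u\<^sub>2)" "exec c \<sigma> u\<^sub>1 \<rho>" "exec (While a c) \<rho> u\<^sub>2 \<tau>'"
    by (rule exec_WhileE) (simp_all add: WhileTrue.hyps)
  from WhileTrue.IH(1)[OF *(2)] have eq: "u\<^sub>1 = t\<^sub>1" "\<rho> = \<sigma>'" by (rule conjunct1, rule conjunct2)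
  from WhileTrue.IH(2)[OF *(3)[unfolded eq]] *(1) eq(1) show ?case by simp
qed (erule exec_SkipE exec_AssignE exec_StoreE; simp)+

text \<open>The input word occupies the cells from address 0 on; everything else is initially 0.\<close>

definition init_state :: "nat list \<Rightarrow> state" where
  "init_state xs = (\<lambda>_. 0, \<lambda>i. if i < length xs then xs ! i else 0)"

text \<open>The answer is read off register 0: a nonzero value means yes.\<close>

definition decides_within :: "com \<Rightarrow> nat list \<Rightarrow> bool \<Rightarrow> real \<Rightarrow> bool" where
  "decides_within P xs ans b \<longleftrightarrow>
     (\<exists>t \<tau>. exec P (init_state xs) t \<tau> \<and> real t \<le> b \<and> (fst \<tau> 0 \<noteq> 0 \<longleftrightarrow> ans))"


section \<open>The kOV conjecture\<close>

text \<open>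
  A set of \<open>n\<close> vectors is given as a list of length \<open>n\<close> without repetitions, in any order; vectors
  are 0-1 lists.
\<close>

definition kOV_instance :: "nat \<Rightarrow> nat \<Rightarrow> nat \<Rightarrow> nat list list list \<Rightarrow> bool" where
  "kOV_instance k n d A \<longleftrightarrow> n \<ge> 1 \<and> d \<ge> 1 \<and> length A = k \<and>
     (\<forall>S \<in> set A. length S = n \<and> distinct S \<and> (\<forall>v \<in> set S. length v = d \<and> set v \<subseteq> {0, 1}))"

definition kOV_encode :: "nat \<Rightarrow> nat \<Rightarrow> nat list list list \<Rightarrow> nat list" where
  "kOV_encode n d A = n # d # concat (map concat A)"

definition kOV :: "nat \<Rightarrow> nat \<Rightarrow> nat list list list \<Rightarrow> bool" where
  "kOV k d A \<longleftrightarrow>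
     (\<exists>a. (\<forall>i<k. a i \<in> set (A ! i)) \<and> (\<forall>l<d. (\<Prod>i<k. a i ! l) = 0))"

text \<open>
  The algorithm, the constant and the polynomial may depend on \<open>k\<close>; since \<open>d \<ge> 1\<close>, bounds
  \<open>poly(d)\<close> and \<open>O(d ^ C)\<close> are the same.
\<close>

definition kOV_conjecture :: bool where
  "kOV_conjecture \<longleftrightarrow>
     (\<forall>k\<ge>2. \<forall>\<epsilon>>0. \<not> (\<exists>P. \<exists>B::real. \<exists>C::nat. \<forall>n d A. kOV_instance k n d A \<longrightarrow>
        decides_within P (kOV_encode n d A) (kOV k d A)
          (B * (real n powr (real k - \<epsilon>) * real d ^ C))))"


section \<open>Factored graphs\<close>

text \<open>
  Vertices are tuples, represented by lists. Products concatenate tuples, so that they are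
  associative on the nose.
\<close>

definition cartesian_product ::
  "'a list pair_pre_digraph \<Rightarrow> 'a list pair_pre_digraph \<Rightarrow> 'a list pair_pre_digraph" where
  "cartesian_product G H =
     \<lparr> pverts = {v @ u | v u. v \<in> pverts G \<and> u \<in> pverts H},
       parcs = {(v\<^sub>1 @ u\<^sub>1, v\<^sub>2 @ u\<^sub>2) | v\<^sub>1 u\<^sub>1 v\<^sub>2 u\<^sub>2.
         v\<^sub>1 \<in> pverts G \<and> v\<^sub>2 \<in> pverts G \<and> u\<^sub>1 \<in> pverts H \<and> u\<^sub>2 \<in> pverts H \<and>
         (v\<^sub>1 = v\<^sub>2 \<and> (u\<^sub>1, u\<^sub>2) \<in> parcs H \<or> u\<^sub>1 = u\<^sub>2 \<and> (v\<^sub>1, v\<^sub>2) \<in> parcs G)} \<rparr>"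

definition tensor_product ::
  "'a list pair_pre_digraph \<Rightarrow> 'a list pair_pre_digraph \<Rightarrow> 'a list pair_pre_digraph" where
  "tensor_product G H =
     \<lparr> pverts = {v @ u | v u. v \<in> pverts G \<and> u \<in> pverts H},
       parcs = {(v\<^sub>1 @ u\<^sub>1, v\<^sub>2 @ u\<^sub>2) | v\<^sub>1 u\<^sub>1 v\<^sub>2 u\<^sub>2.
         (v\<^sub>1, v\<^sub>2) \<in> parcs G \<and> (u\<^sub>1, u\<^sub>2) \<in> parcs H} \<rparr>"

definition graph_union ::
  "'a pair_pre_digraph \<Rightarrow> 'a pair_pre_digraph \<Rightarrow> 'a pair_pre_digraph" where
  "graph_union G H = \<lparr> pverts = pverts G \<union> pverts H, parcs = parcs G \<union> parcs H \<rparr>"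

text \<open>An input graph is given explicitly by its lists of vertices and of edges.\<close>

type_synonym input_graph = "nat list \<times> (nat \<times> nat) list"

definition input_graph_wf :: "input_graph \<Rightarrow> bool" where
  "input_graph_wf g \<longleftrightarrow> distinct (fst g) \<and> distinct (snd g) \<and> set (snd g) \<subseteq> set (fst g) \<times> set (fst g)"

definition graph_of_input :: "input_graph \<Rightarrow> nat list pair_pre_digraph" where
  "graph_of_input g =
     \<lparr> pverts = {[v] | v. v \<in> set (fst g)}, parcs = {([u], [v]) | u v. (u, v) \<in> set (snd g)} \<rparr>"

datatype formula =
    Input nat
  | Cartesian formula formula
  | Tensor formula formula
  | GUnion formula formula

fun num_ops :: "formula \<Rightarrow> nat" where
  "num_ops (Input i) = 0"
| "num_ops (Cartesian f h) = num_ops f + num_ops h + 1"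
| "num_ops (Tensor f h) = num_ops f + num_ops h + 1"
| "num_ops (GUnion f h) = num_ops f + num_ops h + 1"

fun inputs :: "formula \<Rightarrow> nat set" where
  "inputs (Input i) = {i}"
| "inputs (Cartesian f h) = inputs f \<union> inputs h"
| "inputs (Tensor f h) = inputs f \<union> inputs h"
| "inputs (GUnion f h) = inputs f \<union> inputs h"

type_synonym factored_graph = "formula \<times> input_graph list"

fun formula_graph :: "input_graph list \<Rightarrow> formula \<Rightarrow> nat list pair_pre_digraph" where
  "formula_graph Gs (Input i) = graph_of_input (Gs ! i)"
| "formula_graph Gs (Cartesian f h) = cartesian_product (formula_graph Gs f) (formula_graph Gs h)"
| "formula_graph Gs (Tensor f h) = tensor_product (formula_graph Gs f) (formula_graph Gs h)"
| "formula_graph Gs (GUnion f h) = graph_union (formula_graph Gs f) (formula_graph Gs h)"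

definition graph_of :: "factored_graph \<Rightarrow> nat list pair_pre_digraph" where
  "graph_of F = formula_graph (snd F) (fst F)"

definition factored_graph_wf :: "factored_graph \<Rightarrow> bool" where
  "factored_graph_wf F \<longleftrightarrow>
     inputs (fst F) = {..<length (snd F)} \<and> (\<forall>g \<in> set (snd F). input_graph_wf g)"

definition has_complexity :: "factored_graph \<Rightarrow> nat \<Rightarrow> nat \<Rightarrow> bool" where
  "has_complexity F n k \<longleftrightarrow> num_ops (fst F) + 1 = k \<and> (\<forall>g \<in> set (snd F). length (fst g) \<le> n)"

text \<open>
  At most \<open>k\<close> input graphs with at most \<open>n\<close> vertices each have at most \<open>k * n\<close> vertices
  altogether, so up to renaming these are numbers below \<open>k * n\<close>. Without this normalization the
  length of the names would not be bounded in terms of \<open>n\<close> and \<open>k\<close>, and no time bound in terms of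
  \<open>n\<close> and \<open>k\<close> could hold, for the trivial reason that comparing names takes too long.
\<close>

definition names_bounded :: "factored_graph \<Rightarrow> nat \<Rightarrow> nat \<Rightarrow> bool" where
  "names_bounded F n k \<longleftrightarrow> (\<forall>g \<in> set (snd F). set (fst g) \<subseteq> {..<k * n})"


section \<open>Reachability on factored graphs\<close>

type_synonym reach_input = "factored_graph \<times> nat list \<times> nat list"

fun reach_instance :: "nat \<Rightarrow> nat \<Rightarrow> reach_input \<Rightarrow> bool" where
  "reach_instance n k (F, s, t) \<longleftrightarrow>
     factored_graph_wf F \<and> has_complexity F n k \<and> names_bounded F n k \<and>
     s \<in> pverts (graph_of F) \<and> t \<in> pverts (graph_of F)"

fun reach_answer :: "reach_input \<Rightarrow> bool" where
  "reach_answer (F, s, t) \<longleftrightarrow> s \<rightarrow>\<^sup>*\<^bsub>with_proj (graph_of F)\<^esub> t"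

text \<open>Formulas are written in prefix notation; graphs and tuples are preceded by lengths.\<close>

fun encode_formula :: "formula \<Rightarrow> nat list" where
  "encode_formula (Input i) = [0, i]"
| "encode_formula (Cartesian f h) = 1 # encode_formula f @ encode_formula h"
| "encode_formula (Tensor f h) = 2 # encode_formula f @ encode_formula h"
| "encode_formula (GUnion f h) = 3 # encode_formula f @ encode_formula h"

definition encode_tuple :: "nat list \<Rightarrow> nat list" where
  "encode_tuple xs = length xs # xs"

definition encode_input_graph :: "input_graph \<Rightarrow> nat list" where
  "encode_input_graph g =
     encode_tuple (fst g) @ length (snd g) # concat (map (\<lambda>(u, v). [u, v]) (snd g))"

fun reach_encode :: "reach_input \<Rightarrow> nat list" where
  "reach_encode ((f, Gs), s, t) =
     encode_formula f @ length Gs # concat (map encode_input_graph Gs)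
       @ encode_tuple s @ encode_tuple t"

text \<open>
  Solvability by one algorithm for all \<open>k\<close>. The constant hidden in \<open>O(g(k) n ^ C)\<close> is absorbed by
  the arbitrary function \<open>g\<close>.
\<close>

definition fixed_parameter_tractable ::
  "(nat \<Rightarrow> nat \<Rightarrow> 'i \<Rightarrow> bool) \<Rightarrow> ('i \<Rightarrow> nat list) \<Rightarrow> ('i \<Rightarrow> bool) \<Rightarrow> bool" where
  "fixed_parameter_tractable inst enc ans \<longleftrightarrow>
     (\<exists>P. \<exists>g :: nat \<Rightarrow> real. \<exists>C::nat. \<forall>n k x. inst n k x \<longrightarrow>
        decides_within P (enc x) (ans x) (g k * real n ^ C))"

text \<open>Solvability in time \<open>O(T n)\<close> for a fixed \<open>k\<close>, by an algorithm which may depend on \<open>k\<close>.\<close>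

definition solvable_in_time ::
  "(nat \<Rightarrow> nat \<Rightarrow> 'i \<Rightarrow> bool) \<Rightarrow> ('i \<Rightarrow> nat list) \<Rightarrow> ('i \<Rightarrow> bool) \<Rightarrow> nat \<Rightarrow> (nat \<Rightarrow> real) \<Rightarrow> bool" where
  "solvable_in_time inst enc ans k T \<longleftrightarrow>
     (\<exists>P. \<exists>B::real. \<forall>n x. inst n k x \<longrightarrow> decides_within P (enc x) (ans x) (B * T n))"

end

theory Submission
  imports Defs "HOL-Library.Discrete_Functions"
begin

text \<open>
  Given \<open>K\<close> sets of vectors, a graph \<open>G\<close> lets a token choose a vector of its set in the first step
  and then advance through the coordinates of this vector; \<open>H\<close> is the same graph, except that a
  coordinate can be left only if the vector vanishes there. In the tensor product of \<open>K\<close> copies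
  of \<open>G\<close> with one of them replaced by \<open>H\<close>, all tokens move in lockstep, and in the union of these
  products over the position of \<open>H\<close> a step from coordinate \<open>l\<close> to the next is possible iff one of the
  chosen vectors vanishes at \<open>l\<close>. So the end is reachable iff there are orthogonal vectors. This
  formula has complexity \<open>(O(K n d), K\<^sup>2)\<close> and is computed in time \<open>O((n d) ^ 41)\<close> for fixed \<open>K\<close>, whence
  reachability in time \<open>n ^ e\<close> for some \<open>e \<le> K - 1\<close> would refute the conjecture as soon as \<open>K \<ge> 43\<close>.
\<close>

section \<open>The factored graph of an instance of orthogonal vectors\<close>

lemma nth_concat_uniform:
  assumes "\<forall>xs\<in>set xss. length xs = m" "i < length xss" "r < m"
  shows "i * m + r < length (concat xss) \<and> concat xss ! (i * m + r) = xss ! i ! r"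
  using assms
proof (induction xss arbitrary: i)
  case (Cons xs xss)
  show ?case
  proof (cases i)
    case (Suc i')
    with Cons show ?thesis
      by (simp add: nth_append)
  qed (use Cons.prems in \<open>simp add: nth_append\<close>)
qed simp

lemma length_concat_uniform:
  "\<forall>xs\<in>set xss. length xs = m \<Longrightarrow> length (concat xss) = length xss * m"
  by (induction xss) auto

lemma reachable_with_proj_step:
  assumes "s \<rightarrow>\<^sup>*\<^bsub>with_proj G\<^esub> u" "(u, v) \<in> parcs G" "v \<in> pverts G"
  shows "s \<rightarrow>\<^sup>*\<^bsub>with_proj G\<^esub> v"
  using assms unfolding reachable_def arcs_ends_conv
  by (auto intro: rtrancl_on_into_rtrancl_on simp: image_iff)

lemma reachable_with_proj_induct [consumes 1, case_names base step]:
  assumes "s \<rightarrow>\<^sup>*\<^bsub>with_proj G\<^esub> t" "P s"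
    and "\<And>u v. P u \<Longrightarrow> (u, v) \<in> parcs G \<Longrightarrow> P v"
  shows "P t"
  using assms(1) unfolding reachable_def
  by (induction rule: rtrancl_on_induct) (use assms in \<open>auto simp: arcs_ends_conv\<close>)

section \<open>Iterated tensor products and unions\<close>

fun tensor_of :: "formula list \<Rightarrow> formula" where
  "tensor_of [] = undefined"
| "tensor_of [f] = f"
| "tensor_of (f # fs) = Tensor f (tensor_of fs)"

fun gunion_of :: "formula list \<Rightarrow> formula" where
  "gunion_of [] = undefined"
| "gunion_of [f] = f"
| "gunion_of (f # fs) = GUnion f (gunion_of fs)"

lemma num_ops_tensor_of:
  "fs \<noteq> [] \<Longrightarrow> num_ops (tensor_of fs) + 1 = (\<Sum>f\<leftarrow>fs. num_ops f + 1)"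
  by (induction fs rule: tensor_of.induct) auto

lemma num_ops_gunion_of:
  "fs \<noteq> [] \<Longrightarrow> num_ops (gunion_of fs) + 1 = (\<Sum>f\<leftarrow>fs. num_ops f + 1)"
  by (induction fs rule: gunion_of.induct) auto

lemma inputs_tensor_of: "fs \<noteq> [] \<Longrightarrow> inputs (tensor_of fs) = (\<Union>f\<in>set fs. inputs f)"
  by (induction fs rule: tensor_of.induct) auto

lemma inputs_gunion_of: "fs \<noteq> [] \<Longrightarrow> inputs (gunion_of fs) = (\<Union>f\<in>set fs. inputs f)"
  by (induction fs rule: gunion_of.induct) auto

definition singleton_graph :: "nat set \<Rightarrow> (nat \<times> nat) set \<Rightarrow> nat list pair_pre_digraph" where
  "singleton_graph V R = \<lparr>pverts = {[v] | v. v \<in> V}, parcs = {([u], [v]) | u v. (u, v) \<in> R}\<rparr>"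

text \<open>Normal form for iterated tensor products whose factors share the vertex set
  \<open>V\<close>; flattened tuples make it independent of the bracketing.\<close>

definition tuple_graph :: "nat set \<Rightarrow> (nat \<times> nat) set list \<Rightarrow> nat list pair_pre_digraph" where
  "tuple_graph V Rs =
     \<lparr>pverts = {xs. length xs = length Rs \<and> set xs \<subseteq> V},
      parcs = {(xs, ys). length xs = length Rs \<and> length ys = length Rs \<and>
        (\<forall>j<length Rs. (xs ! j, ys ! j) \<in> Rs ! j)}\<rparr>"

lemma tuple_graph_singleton: "tuple_graph V [R] = singleton_graph V R"
  unfolding tuple_graph_def singleton_graph_def by (auto simp: length_Suc_conv)

lemma tensor_singleton_tuple:
  "tensor_product (singleton_graph V R) (tuple_graph V Rs) = tuple_graph V (R # Rs)"
proof (intro pair_pre_digraph.equality, goal_cases)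
  case 1
  show ?case
    unfolding tuple_graph_def singleton_graph_def tensor_product_def
    by (auto simp: length_Suc_conv) (metis append_Cons append_Nil)
next
  case 2
  have *: "(xs, ys) \<in> parcs (tensor_product (singleton_graph V R) (tuple_graph V Rs)) \<longleftrightarrow>
    (xs, ys) \<in> parcs (tuple_graph V (R # Rs))" for xs ys
    unfolding tuple_graph_def singleton_graph_def tensor_product_def
    by (cases xs; cases ys) (auto simp: All_less_Suc2, metis append_Cons append_Nil)
  show ?case
    by (intro equalityI subrelI) (simp_all only: *)
qed auto

lemma formula_graph_tensor_of:
  assumes "fs \<noteq> []" "list_all2 (\<lambda>f R. formula_graph Gs f = singleton_graph V R) fs Rs"
  shows "formula_graph Gs (tensor_of fs) = tuple_graph V Rs"
  using assms
proof (induction fs arbitrary: Rs rule: tensor_of.induct)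
  case (3 f g fs)
  then obtain R Rs' where "Rs = R # Rs'" by (auto simp: list_all2_Cons1)
  with 3 have "formula_graph Gs (tensor_of (g # fs)) = tuple_graph V Rs'"
    by (intro "3.IH") auto
  with 3 \<open>Rs = R # Rs'\<close> show ?case by (simp add: tensor_singleton_tuple)
qed (auto simp: list_all2_Cons1 tuple_graph_singleton)

lemma formula_graph_gunion_of:
  assumes "fs \<noteq> []"
  shows "formula_graph Gs (gunion_of fs) =
    \<lparr>pverts = (\<Union>f\<in>set fs. pverts (formula_graph Gs f)),
     parcs = (\<Union>f\<in>set fs. parcs (formula_graph Gs f))\<rparr>"
  using assms by (induction fs rule: gunion_of.induct) (auto simp: graph_union_def)

lemma graph_of_input_singleton: "graph_of_input g = singleton_graph (set (fst g)) (set (snd g))"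
  unfolding graph_of_input_def singleton_graph_def ..

section \<open>The formula of the reduction and the graph it denotes\<close>

lemma graph_union_idem: "graph_union G G = (G :: 'a pair_pre_digraph)"
  by (simp add: graph_union_def)

text \<open>Fills up the number of operations to an arbitrary prescribed value.\<close>

fun pad :: "nat \<Rightarrow> formula" where
  "pad 0 = Input 1"
| "pad (Suc r) = GUnion (Input 1) (pad r)"

text \<open>Union with the same graph changes nothing, so padding raises only the operation
  count.\<close>

lemma formula_graph_pad: "formula_graph Gs (pad r) = graph_of_input (Gs ! 1)"
  by (induction r) (auto simp: graph_union_idem)

lemma num_ops_pad: "num_ops (pad r) = r"
  by (induction r) auto

lemma inputs_pad: "inputs (pad r) = {1}"
  by (induction r) auto

text \<open>Input 1 is the filtered graph, placed at position \<open>i\<close>; input 0 is the plain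
  one. All padding goes into a single leaf, the diagonal one of product 0, so that it is counted
  once.\<close>

definition ov_leaf :: "nat \<Rightarrow> nat \<Rightarrow> nat \<Rightarrow> formula" where
  "ov_leaf r i j = (if j = i then pad (if i = 0 then r else 0) else Input 0)"

definition ov_formula :: "nat \<Rightarrow> nat \<Rightarrow> formula" where
  "ov_formula K r = gunion_of (map (\<lambda>i. tensor_of (map (ov_leaf r i) [0..<K])) [0..<K])"

text \<open>Operations plus one is the number of leaves: \<open>K\<close> products with
  \<open>K\<close> leaves each, and \<open>r\<close> further leaves from the padding.\<close>

lemma num_ops_ov_formula:
  assumes "K \<ge> 1"
  shows "num_ops (ov_formula K r) + 1 = K\<^sup>2 + r"
proof -
  have "num_ops (ov_leaf r i j) = (if j = 0 then if i = 0 then r else 0 else 0)" for i j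
    by (auto simp: ov_leaf_def num_ops_pad)
  then have *: "(\<Sum>j\<leftarrow>[0..<K]. num_ops (ov_leaf r i j) + 1) = K + (if i = 0 then r else 0)" for i
    using assms by (simp add: interv_sum_list_conv_sum_set_nat sum_Suc)
  have "num_ops (tensor_of (map (ov_leaf r i) [0..<K])) + 1 = K + (if i = 0 then r else 0)" for i
    using num_ops_tensor_of[of "map (ov_leaf r i) [0..<K]"] assms * by (simp add: comp_def)
  then have "(\<Sum>i\<leftarrow>[0..<K]. num_ops (tensor_of (map (ov_leaf r i) [0..<K])) + 1) = K * K + r"
    using assms by (simp add: interv_sum_list_conv_sum_set_nat sum.distrib sum.delta)
  then show ?thesis
    unfolding ov_formula_def
    using assms num_ops_gunion_of[of "map (\<lambda>i. tensor_of (map (ov_leaf r i) [0..<K])) [0..<K]"]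
    by (simp add: comp_def power2_eq_square)
qed

text \<open>With \<open>K \<ge> 2\<close> every product has an off-diagonal leaf, so both inputs
  occur, as well-formedness of the factored graph demands.\<close>

lemma inputs_ov_formula:
  assumes "K \<ge> 2"
  shows "inputs (ov_formula K r) = {0, 1}"
proof -
  have *: "inputs (ov_formula K r) = (\<Union>i\<in>{..<K}. \<Union>j\<in>{..<K}. inputs (ov_leaf r i j))"
    unfolding ov_formula_def using assms
    by (subst inputs_gunion_of) (simp_all add: inputs_tensor_of atLeast0LessThan)
  have leaf: "inputs (ov_leaf r i j) = (if j = i then {1} else {0})" for i j
    by (simp add: ov_leaf_def inputs_pad)
  have mem: "0 \<in> {..<K}" "1 \<in> {..<K}"
    using assms by auto
  show ?thesis
    unfolding *
  proof (intro equalityI subsetI)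
    fix x assume x: "x \<in> {0::nat, 1}"
    show "x \<in> (\<Union>i\<in>{..<K}. \<Union>j\<in>{..<K}. inputs (ov_leaf r i j))"
    proof (cases "x = 0")
      case True
      then show ?thesis
        using leaf mem by (intro UN_I[of 0] UN_I[of 1]) auto
    next
      case False
      then show ?thesis
        using x leaf mem by (intro UN_I[of 0]) auto
    qed
  qed (auto simp: leaf split: if_splits)
qed

text \<open>The union over the position of \<open>H\<close> becomes the quantifier over
  \<open>i\<close>. Equal vertex lists give all products the same vertex set, so the union adds no
  vertices.\<close>

lemma graph_of_ov_formula:
  assumes "K \<ge> 1" "fst G = fst H"
  shows "graph_of (ov_formula K r, [G, H]) =
    \<lparr>pverts = {xs. length xs = K \<and> set xs \<subseteq> set (fst G)},
     parcs = {(xs, ys). length xs = K \<and> length ys = K \<and>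
       (\<exists>i<K. \<forall>j<K. (xs ! j, ys ! j) \<in> set (snd (if j = i then H else G)))}\<rparr>"
proof -
  have *: "formula_graph [G, H] (tensor_of (map (ov_leaf r i) [0..<K])) =
    tuple_graph (set (fst G)) (map (\<lambda>j. set (snd (if j = i then H else G))) [0..<K])" for i
    by (rule formula_graph_tensor_of)
       (use assms in \<open>auto simp: list_all2_conv_all_nth ov_leaf_def formula_graph_pad
         graph_of_input_singleton\<close>)
  have ne: "{..<K} \<noteq> {}" "K \<noteq> 0"
    using assms(1) by (auto simp: lessThan_empty_iff)
  show ?thesis
    unfolding graph_of_def ov_formula_def fst_conv snd_conv
    by (subst formula_graph_gunion_of)
       (simp_all add: * tuple_graph_def atLeast0LessThan ne, fastforce?)
qed

section \<open>The two input graphs and the reachability instance\<close>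

locale ov_graph =
  fixes K n d :: nat and bit :: "nat \<Rightarrow> bool"
  assumes K: "K \<ge> 2" and n: "n \<ge> 1" and d: "d \<ge> 1"
begin

abbreviation "E \<equiv> K * n * d"

text \<open>
  Encoding of vertices: the pair of the vector with number \<open>v\<close> (counted through all \<open>K\<close> sets) and
  the coordinate \<open>l\<close> is \<open>v * d + l\<close>, which is also the position of its bit in the input; \<open>E\<close> is the
  target, \<open>E + 1 + j\<close> the start for the \<open>j\<close>-th set and \<open>E + K + 1\<close> a dead end. Sending the forbidden
  edges to a dead end instead of deleting them makes all positions in the encoding computable in
  advance.
\<close>

definition next_pos :: "nat \<Rightarrow> nat" where
  "next_pos q = (if Suc q mod d = 0 then E else Suc q)"

definition filtered_pos :: "nat \<Rightarrow> nat" where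
  "filtered_pos q = (if bit q then E + K + 1 else next_pos q)"

text \<open>First the edges between coordinates, then the start edges, with \<open>v div n\<close>
  as the number of the set of \<open>v\<close>. The length \<open>E + K * n\<close> does not depend
  on \<open>f\<close>.\<close>

definition ov_edges :: "(nat \<Rightarrow> nat) \<Rightarrow> (nat \<times> nat) list" where
  "ov_edges f = map (\<lambda>q. (q, f q)) [0..<E] @ map (\<lambda>v. (E + 1 + v div n, v * d)) [0..<K * n]"

definition ov_input :: "(nat \<Rightarrow> nat) \<Rightarrow> input_graph" where
  "ov_input f = ([0..<E + K + 2], ov_edges f)"

definition ov_start :: "nat list" where
  "ov_start = map (\<lambda>j. E + 1 + j) [0..<K]"

definition ov_end :: "nat list" where
  "ov_end = replicate K E"

definition ov_instance :: "nat \<Rightarrow> reach_input" where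
  "ov_instance r = ((ov_formula K r, [ov_input next_pos, ov_input filtered_pos]), ov_start, ov_end)"

lemma pos_less: "v < K * n \<Longrightarrow> l < d \<Longrightarrow> v * d + l < E"
proof -
  assume "v < K * n" "l < d"
  then have "v * d + l < Suc v * d" by simp
  also have "\<dots> \<le> K * n * d" using \<open>v < K * n\<close> by (intro mult_right_mono) auto
  finally show ?thesis .
qed

lemma set_ov_edges:
  "(u, w) \<in> set (ov_edges f) \<longleftrightarrow>
    u < E \<and> w = f u \<or> (\<exists>v<K * n. u = E + 1 + v div n \<and> w = v * d)"
  unfolding ov_edges_def by auto

lemma next_pos_le: "q < E \<Longrightarrow> next_pos q \<le> E"
  by (auto simp: next_pos_def)

lemma filtered_pos_le: "q < E \<Longrightarrow> filtered_pos q \<le> E + K + 1"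
  using next_pos_le[of q] by (auto simp: filtered_pos_def)

lemma ov_edges_less:
  assumes "\<And>q. q < E \<Longrightarrow> f q \<le> E + K + 1" "(u, w) \<in> set (ov_edges f)"
  shows "u < E + K + 2 \<and> w < E + K + 2"
  using assms(2) unfolding set_ov_edges
proof (elim disjE exE conjE)
  assume u: "u < E" "w = f u"
  from assms(1)[OF u(1)] u(1) show ?thesis unfolding u(2) by linarith
next
  fix v assume v: "v < K * n" "u = E + 1 + v div n" "w = v * d"
  have "v div n < K" using v(1) by (rule less_mult_imp_div_less)
  moreover have "v * d < E" using pos_less[OF v(1), of 0] d by simp
  ultimately show ?thesis unfolding v(2,3) by linarith
qed

lemma input_graph_wf_ov:
  assumes "\<And>q. q < E \<Longrightarrow> f q \<le> E + K + 1"
  shows "input_graph_wf (ov_input f)"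
proof -
  \<comment> \<open>Sources lie below \<open>E\<close> in the first block and above it in the
    second, where \<open>v * d\<close> determines \<open>v\<close> because
    \<open>d \<ge> 1\<close>.\<close>
  have "distinct (ov_edges f)"
    unfolding ov_edges_def using d by (auto simp: distinct_map inj_on_def)
  moreover have "set (ov_edges f) \<subseteq> {..<E + K + 2} \<times> {..<E + K + 2}"
    using ov_edges_less[OF assms] by (intro subrelI) simp
  ultimately show ?thesis
    unfolding input_graph_wf_def ov_input_def by (simp add: atLeast0LessThan del: upt_Suc)
qed

lemma graph_ov_instance:
  "graph_of (fst (ov_instance r)) =
    \<lparr>pverts = {xs. length xs = K \<and> set xs \<subseteq> {..<E + K + 2}},
     parcs = {(xs, ys). length xs = K \<and> length ys = K \<and>
       (\<exists>i<K. \<forall>j<K. (xs ! j, ys ! j) \<in> set (ov_edges (if j = i then filtered_pos else next_pos)))}\<rparr>"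
proof -
  have "snd (if c then ov_input filtered_pos else ov_input next_pos) =
      ov_edges (if c then filtered_pos else next_pos)" for c
    by (simp add: ov_input_def)
  then show ?thesis
    unfolding ov_instance_def fst_conv
    using K by (subst graph_of_ov_formula) (auto simp: ov_input_def)
qed

lemma reach_instance_ov: "reach_instance (E + K + 2) (K\<^sup>2 + r) (ov_instance r)"
proof -
  \<comment> \<open>The number of leaves is at least 1, so vertex names below
    \<open>E + K + 2\<close> respect the bound on names.\<close>
  have "1 * (E + K + 2) \<le> (K\<^sup>2 + r) * (E + K + 2)"
    using K by (intro mult_right_mono) (simp_all add: Suc_leI)
  then have "{..<E + K + 2} \<subseteq> {..<(K\<^sup>2 + r) * (E + K + 2)}"
    by simp
  moreover have "set (fst g) = {..<E + K + 2}" if "g \<in> set (snd (fst (ov_instance r)))" for g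
    using that by (simp add: ov_instance_def ov_input_def atLeast0LessThan del: upt_Suc) auto
  ultimately have "names_bounded (fst (ov_instance r)) (E + K + 2) (K\<^sup>2 + r)"
    unfolding names_bounded_def by (intro ballI) (simp only:)
  moreover have "factored_graph_wf (fst (ov_instance r))"
    unfolding factored_graph_wf_def ov_instance_def
    using K next_pos_le input_graph_wf_ov[of next_pos] input_graph_wf_ov[of filtered_pos]
      filtered_pos_le
    by (auto simp: inputs_ov_formula lessThan_Suc numeral_2_eq_2 intro: trans_le_add1 le_SucI)
  moreover have "has_complexity (fst (ov_instance r)) (E + K + 2) (K\<^sup>2 + r)"
    unfolding has_complexity_def ov_instance_def
    using K num_ops_ov_formula[of K r] by (auto simp: ov_input_def)
  moreover have "ov_start \<in> pverts (graph_of (fst (ov_instance r)))"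
    "ov_end \<in> pverts (graph_of (fst (ov_instance r)))"
    unfolding graph_ov_instance by (auto simp: ov_start_def ov_end_def)
  ultimately show ?thesis
    by (simp add: ov_instance_def)
qed

section \<open>Walks in the product and orthogonal choices\<close>

definition pos :: "nat \<Rightarrow> nat \<Rightarrow> nat" where
  "pos v l = (if l < d then v * d + l else E)"

lemma next_pos_pos:
  assumes "v < K * n" "l < d"
  shows "next_pos (v * d + l) = pos v (Suc l)"
proof -
  have "Suc (v * d + l) mod d = (if Suc l = d then 0 else Suc l)"
    using assms(2) mod_mult_self3[of v d "Suc l"] by (auto simp del: mod_mult_self3)
  then show ?thesis
    using assms by (auto simp: next_pos_def pos_def)
qed

lemma pos_zero: "pos v 0 = v * d"
  using d by (simp add: pos_def)

lemma pos_le: "v < K * n \<Longrightarrow> pos v l \<le> E"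
  using pos_less[of v l] by (auto simp: pos_def)

definition ov_choice :: "(nat \<Rightarrow> nat) \<Rightarrow> bool" where
  "ov_choice v \<longleftrightarrow> (\<forall>j<K. v j < K * n \<and> v j div n = j)"

text \<open>Orthogonality in the first \<open>l\<close> coordinates only, to serve as an invariant
  along a walk.\<close>

definition ov_orth :: "(nat \<Rightarrow> nat) \<Rightarrow> nat \<Rightarrow> bool" where
  "ov_orth v l \<longleftrightarrow> (\<forall>l'<l. \<exists>i<K. \<not> bit (v i * d + l'))"

text \<open>An orthogonal choice yields the walk that has token \<open>j\<close> at
  \<open>pos (v j) l\<close> for \<open>l = 0, ..., d\<close>. Conversely, the first step of any
  walk fixes a choice, and each later step either confirms one more coordinate or traps a token at
  the dead end.\<close>

lemma reach_answer_ov: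
  "reach_answer (ov_instance r) \<longleftrightarrow> (\<exists>v. ov_choice v \<and> ov_orth v d)"
proof -
  let ?G = "graph_of (fst (ov_instance r))"
  have "ov_start \<rightarrow>\<^sup>*\<^bsub>with_proj ?G\<^esub> ov_end \<longleftrightarrow> (\<exists>v. ov_choice v \<and> ov_orth v d)"
  proof
    assume "\<exists>v. ov_choice v \<and> ov_orth v d"
    then obtain v where v: "ov_choice v" "ov_orth v d" by blast
    have vert: "map (\<lambda>j. pos (v j) l) [0..<K] \<in> pverts ?G" for l
    proof -
      have "pos (v j) l < E + K + 2" if "j < K" for j
        using pos_le[of "v j" l] v(1) that by (simp add: ov_choice_def)
      then show ?thesis
        unfolding graph_ov_instance by auto
    qed
    have "ov_start \<rightarrow>\<^sup>*\<^bsub>with_proj ?G\<^esub> map (\<lambda>j. pos (v j) l) [0..<K]" if "l \<le> d" for l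
      using that
    proof (induction l)
      case 0
      have "ov_start \<in> pverts ?G"
        unfolding graph_ov_instance by (auto simp: ov_start_def)
      then have "ov_start \<rightarrow>\<^sup>*\<^bsub>with_proj ?G\<^esub> ov_start"
        by (simp add: reachable_def)
      moreover have "(ov_start, map (\<lambda>j. pos (v j) 0) [0..<K]) \<in> parcs ?G"
      proof -
        \<comment> \<open>Start edges belong to both graphs, so any position may carry the filter in
          the first step.\<close>
        have "(ov_start ! j, pos (v j) 0) \<in> set (ov_edges f)" if "j < K" for j f
          using v(1) that
          unfolding set_ov_edges ov_start_def ov_choice_def pos_zero
          by (intro disjI2 exI[of _ "v j"]) auto
        then show ?thesis
          unfolding graph_ov_instance using K
          by (simp add: ov_start_def) (meson K less_le_trans zero_less_numeral)
      qed
      ultimately show ?case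
        using vert by (rule reachable_with_proj_step)
    next
      case (Suc l)
      \<comment> \<open>The filter is put on a token whose vector vanishes at \<open>l\<close>;
        there it does not block.\<close>
      then obtain i where i: "i < K" "\<not> bit (v i * d + l)"
        using v(2) unfolding ov_orth_def by (meson Suc_le_eq)
      have "(map (\<lambda>j. pos (v j) l) [0..<K], map (\<lambda>j. pos (v j) (Suc l)) [0..<K]) \<in> parcs ?G"
        unfolding graph_ov_instance using v(1) i Suc.prems
        by (auto simp: set_ov_edges ov_choice_def pos_less next_pos_pos filtered_pos_def
            pos_def[of _ l] intro!: exI[of _ i])
      then show ?case
        using vert Suc by (intro reachable_with_proj_step[OF _ _ vert]) auto
    qed
    from this[of d] show "ov_start \<rightarrow>\<^sup>*\<^bsub>with_proj ?G\<^esub> ov_end"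
      by (simp add: pos_def ov_end_def map_replicate_const)
  next
    \<comment> \<open>Invariant of the tuples reachable from the start; the second disjunct covers
      walks that have failed a check.\<close>
    define P where "P xs \<longleftrightarrow> xs = ov_start \<or> E + K + 1 \<in> set xs \<or>
      (\<exists>v l. ov_choice v \<and> ov_orth v l \<and> l \<le> d \<and> xs = map (\<lambda>j. pos (v j) l) [0..<K])" for xs
    assume "ov_start \<rightarrow>\<^sup>*\<^bsub>with_proj ?G\<^esub> ov_end"
    then have "P ov_end"
    proof (induction rule: reachable_with_proj_induct)
      case (step xs ys)
      from step(2) obtain i where len: "length xs = K" "length ys = K" and i: "i < K"
        and e: "\<And>j. j < K \<Longrightarrow>
          (xs ! j, ys ! j) \<in> set (ov_edges (if j = i then filtered_pos else next_pos))"
        unfolding graph_ov_instance by auto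
      consider "xs = ov_start" | "E + K + 1 \<in> set xs"
        | v l where "ov_choice v" "ov_orth v l" "l \<le> d" "xs = map (\<lambda>j. pos (v j) l) [0..<K]"
        using step(1) unfolding P_def by blast
      then show ?case
      proof cases
        case 1
        have "\<exists>v<K * n. v div n = j \<and> ys ! j = v * d" if "j < K" for j
          using e[OF that] that unfolding 1 ov_start_def by (auto simp: set_ov_edges)
        then obtain v where v: "\<And>j. j < K \<Longrightarrow> v j < K * n \<and> v j div n = j \<and> ys ! j = v j * d"
          by metis
        then have "ys = map (\<lambda>j. pos (v j) 0) [0..<K]"
          using len by (auto intro: nth_equalityI simp: pos_zero)
        moreover have "ov_choice v" "ov_orth v 0"
          using v by (auto simp: ov_choice_def ov_orth_def)
        ultimately show ?thesis unfolding P_def by blast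
      next
        case 2
        then obtain j where j: "j < K" "xs ! j = E + K + 1"
          using len by (auto simp: in_set_conv_nth)
        \<comment> \<open>An edge leaving the dead end would be a start edge of a set with number
          \<open>K\<close>, but the sets are numbered below \<open>K\<close>.\<close>
        from e[OF j(1)] have "\<exists>v<K * n. v div n = K"
          unfolding j(2) set_ov_edges by auto
        then have False
          by (metis less_mult_imp_div_less less_irrefl)
        then show ?thesis ..
      next
        case 3
        then have v: "v j < K * n" if "j < K" for j
          using that by (auto simp: ov_choice_def)
        \<comment> \<open>At \<open>l = d\<close> all tokens are at \<open>E\<close>, which has no
          outgoing edge.\<close>
        have "l \<noteq> d"
        proof
          assume "l = d"
          with e[of 0] K 3 show False by (auto simp: set_ov_edges pos_def)
        qed
        with 3 have l: "l < d" by simp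
        have ys: "ys ! j = (if j = i then filtered_pos else next_pos) (v j * d + l)" if "j < K" for j
          using e[OF that] 3(4) l that pos_less[OF v[OF that] l]
          by (auto simp: set_ov_edges pos_def)
        show ?thesis
        \<comment> \<open>The filtered token \<open>i\<close> decides: a 1 sends it to the dead end,
          a 0 is the witness for orthogonality at \<open>l\<close>.\<close>
        proof (cases "bit (v i * d + l)")
          case True
          with ys[OF i] have "ys ! i = E + K + 1" by (simp add: filtered_pos_def)
          then have "E + K + 1 \<in> set ys" using i len by (metis nth_mem)
          then show ?thesis by (simp add: P_def)
        next
          case False
          then have "ys ! j = pos (v j) (Suc l)" if "j < K" for j
            using ys[OF that] next_pos_pos[OF v[OF that] l] by (auto simp: filtered_pos_def)
          then have "ys = map (\<lambda>j. pos (v j) (Suc l)) [0..<K]"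
            using len by (auto intro: nth_equalityI)
          moreover have "ov_orth v (Suc l)"
            using 3(2) False i by (auto simp: ov_orth_def less_Suc_eq)
          ultimately show ?thesis unfolding P_def using 3 l by (metis Suc_leI)
        qed
      qed
    qed (simp add: P_def)
    moreover have "ov_end \<noteq> ov_start"
    proof
      assume "ov_end = ov_start"
      then have "ov_end ! 0 = ov_start ! 0" by simp
      then show False using K by (simp add: ov_end_def ov_start_def)
    qed
    moreover have "E + K + 1 \<notin> set ov_end"
      by (simp add: ov_end_def)
    ultimately obtain v l where v: "ov_choice v" "ov_orth v l" "l \<le> d"
      "ov_end = map (\<lambda>j. pos (v j) l) [0..<K]"
      unfolding P_def by blast
    \<comment> \<open>Positions with \<open>l < d\<close> lie below \<open>E\<close>, so coordinate
      0 alone forces \<open>l = d\<close>.\<close>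
    have "ov_end ! 0 = pos (v 0) l"
      using v(4) K by simp
    then have "pos (v 0) l = E"
      using K by (simp add: ov_end_def)
    moreover have "v 0 < K * n"
      using v(1) K by (auto simp: ov_choice_def)
    ultimately have "l = d"
      using v(3) pos_less[of "v 0" l] by (auto simp: pos_def split: if_splits)
    with v show "\<exists>v. ov_choice v \<and> ov_orth v d" by blast
  qed
  then show ?thesis by (simp add: ov_instance_def)
qed

end

section \<open>Vectors addressed by their positions in the flat input\<close>

lemma concat_concat: "concat (concat xsss) = concat (map concat xsss)"
  by (induction xsss) auto

text \<open>Vector \<open>u\<close> of set \<open>j\<close> has number \<open>j * n + u\<close>, and
  its coordinate \<open>l\<close> sits at that number times \<open>d\<close> plus \<open>l\<close>.
  A product of bits is 0 iff one of them is.\<close>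

lemma kOV_iff_positions:
  assumes inst: "kOV_instance K n d A" and K: "K \<ge> 2"
  defines "w \<equiv> concat (map concat A)"
  shows "kOV K d A \<longleftrightarrow> (\<exists>v. ov_graph.ov_choice K n v \<and> ov_graph.ov_orth K d (\<lambda>q. 0 < w ! q) v d)"
proof -
  interpret ov_graph K n d "\<lambda>q. 0 < w ! q"
    using inst K by unfold_locales (auto simp: kOV_instance_def)
  have A: "length A = K" "\<And>S. S \<in> set A \<Longrightarrow> length S = n"
    "\<And>S v. S \<in> set A \<Longrightarrow> v \<in> set S \<Longrightarrow> length v = d"
    using inst by (auto simp: kOV_instance_def)
  have w: "w ! ((j * n + u) * d + l) = A ! j ! u ! l" if "j < K" "u < n" "l < d" for j u l
  proof -
    have w': "w = concat (concat A)" by (simp add: w_def concat_concat)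
    have 1: "j * n + u < length (concat A) \<and> concat A ! (j * n + u) = A ! j ! u"
      using that A by (intro nth_concat_uniform) auto
    have "concat (concat A) ! ((j * n + u) * d + l) = concat A ! (j * n + u) ! l"
      using that 1 A by (intro nth_concat_uniform[THEN conjunct2]) auto
    with 1 w' show ?thesis by simp
  qed
  show ?thesis
  proof
    assume "kOV K d A"
    then obtain a where a: "\<And>i. i < K \<Longrightarrow> a i \<in> set (A ! i)" "\<And>l. l < d \<Longrightarrow> (\<Prod>i<K. a i ! l) = 0"
      unfolding kOV_def by blast
    have "\<exists>u<n. a i = A ! i ! u" if "i < K" for i
      using a(1)[OF that] A that by (metis in_set_conv_nth)
    then obtain u where u: "\<And>i. i < K \<Longrightarrow> u i < n \<and> a i = A ! i ! u i" by metis
    define v where "v j = j * n + u j" for j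
    have "ov_choice v"
      unfolding ov_choice_def
    proof (intro allI impI conjI)
      fix j assume j: "j < K"
      have "v j < Suc j * n" using u[OF j] by (simp add: v_def)
      also have "\<dots> \<le> K * n" using j by (intro mult_right_mono) auto
      finally show "v j < K * n" .
      show "v j div n = j" using u[OF j] by (simp add: v_def)
    qed
    moreover have "ov_orth v d"
      unfolding ov_orth_def
    proof (intro allI impI)
      fix l assume l: "l < d"
      from a(2)[OF l] obtain i where "i < K" "a i ! l = 0" by auto
      with w[OF \<open>i < K\<close> _ l] u show "\<exists>i<K. \<not> 0 < w ! (v i * d + l)"
        unfolding v_def by auto
    qed
    ultimately show "\<exists>v. ov_choice v \<and> ov_orth v d" by blast
  next
    assume "\<exists>v. ov_choice v \<and> ov_orth v d"
    then obtain v where v: "ov_choice v" "ov_orth v d" by blast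
    define a where "a i = A ! i ! (v i mod n)" for i
    have vd: "v i = i * n + v i mod n" if "i < K" for i
      using v(1) that div_mult_mod_eq[of "v i" n] by (auto simp: ov_choice_def)
    have "a i \<in> set (A ! i)" if "i < K" for i
      using that A n by (simp add: a_def)
    moreover have "(\<Prod>i<K. a i ! l) = 0" if l: "l < d" for l
    proof -
      obtain i where i: "i < K" "w ! (v i * d + l) = 0"
        using v(2) l unfolding ov_orth_def by auto
      have "a i ! l = 0"
        using w[OF i(1) _ l, of "v i mod n"] vd[OF i(1)] i(2) n by (simp add: a_def)
      with i(1) show ?thesis by auto
    qed
    ultimately show "kOV K d A" unfolding kOV_def by blast
  qed
qed

section \<open>Computing the factored graph\<close>

fun asize :: "aexp \<Rightarrow> nat" where
  "asize (Const c) = 1"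
| "asize (Reg r) = 1"
| "asize (Mem a) = asize a + 1"
| "asize (Bin f a b) = asize a + asize b + 1"

fun consts_le :: "nat \<Rightarrow> aexp \<Rightarrow> bool" where
  "consts_le M (Const c) \<longleftrightarrow> c \<le> M"
| "consts_le M (Reg r) \<longleftrightarrow> True"
| "consts_le M (Mem a) \<longleftrightarrow> consts_le M a"
| "consts_le M (Bin f a b) \<longleftrightarrow> consts_le M a \<and> consts_le M b"

definition bounded_state :: "nat \<Rightarrow> state \<Rightarrow> bool" where
  "bounded_state M \<sigma> \<longleftrightarrow> (\<forall>r. fst \<sigma> r \<le> M) \<and> (\<forall>i. snd \<sigma> i \<le> M)"

lemma nat_cost_le: "nat_cost x \<le> x + 1"
  by (simp add: nat_cost_def floorlog_le_iff less_exp)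

text \<open>
  All programs below use expressions of bounded size, so bounding the cost by a huge fixed power of
  the largest number that occurs is good enough: the exponent does not depend on \<open>K\<close>.
\<close>

lemma aval_le:
  assumes "bounded_state M \<sigma>" "consts_le M e" "2 \<le> M"
  shows "aval e \<sigma> \<le> M ^ asize e"
  using assms(2)
proof (induction e)
  case (Mem a)
  have "M ^ 1 \<le> M ^ asize (Mem a)"
    using assms(3) by (intro power_increasing) auto
  then show ?case
    using assms(1) by (auto simp: bounded_state_def intro: order_trans)
next
  case (Bin f a b)
  let ?A = "M ^ asize a" and ?B = "M ^ asize b"
  have IH: "aval a \<sigma> \<le> ?A" "aval b \<sigma> \<le> ?B"
    using Bin by auto
  have pos: "1 \<le> ?A" "1 \<le> ?B"
    using assms(3) by simp_all
  have "?A * 1 \<le> ?A * ?B" "1 * ?B \<le> ?A * ?B"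
    using pos by (intro mult_mono; simp)+
  moreover have "2 * (?A * ?B) \<le> M * (?A * ?B)"
    using assms(3) by (intro mult_mono) auto
  moreover have "M ^ asize (Bin f a b) = M * (?A * ?B)"
    by (simp add: power_add mult_ac)
  moreover have "1 * 1 \<le> ?A * ?B"
    using pos by (rule mult_mono) auto
  ultimately have AB: "?A + ?B \<le> M ^ asize (Bin f a b)" "?A * ?B \<le> M ^ asize (Bin f a b)"
    "1 \<le> M ^ asize (Bin f a b)"
    by linarith+
  have "aval a \<sigma> * aval b \<sigma> \<le> ?A * ?B"
    using IH by (rule mult_mono) auto
  moreover have "aval a \<sigma> div aval b \<sigma> \<le> M ^ asize (Bin f a b)"
    "aval a \<sigma> mod aval b \<sigma> \<le> M ^ asize (Bin f a b)"
    using IH(1) AB(1) div_le_dividend[of "aval a \<sigma>" "aval b \<sigma>"]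
      mod_less_eq_dividend[of "aval a \<sigma>" "aval b \<sigma>"] by linarith+
  ultimately show ?case
    using IH AB by (cases f) (auto simp del: asize.simps)
qed (use assms in \<open>auto simp: bounded_state_def\<close>)

text \<open>Each of the \<open>asize e\<close> nodes costs at most its value plus 1, hence at most
  \<open>2 * M ^ asize e\<close> by \<open>aval_le\<close>.\<close>

lemma acost_le:
  assumes "bounded_state M \<sigma>" "consts_le M e" "2 \<le> M"
  shows "acost e \<sigma> \<le> 2 * asize e * M ^ asize e"
  using assms(2)
proof (induction e)
  case (Const c)
  then show ?case using nat_cost_le[of c] assms(3) by simp
next
  case (Reg r)
  have "fst \<sigma> r \<le> M" using assms(1) by (simp add: bounded_state_def)
  then show ?case using nat_cost_le[of "fst \<sigma> r"] assms(3) by simp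
next
  case (Mem a)
  have "nat_cost (aval (Mem a) \<sigma>) \<le> M ^ asize (Mem a) + 1"
    using nat_cost_le[of "aval (Mem a) \<sigma>"] aval_le[OF assms(1) Mem.prems assms(3)] by simp
  moreover have "1 \<le> M ^ asize (Mem a)"
    using assms(3) by simp
  moreover have "2 * asize a * M ^ asize a \<le> 2 * asize a * M ^ asize (Mem a)"
    using assms(3) by (intro mult_left_mono power_increasing) auto
  moreover have "acost a \<sigma> \<le> 2 * asize a * M ^ asize a"
    using Mem by simp
  moreover have "acost (Mem a) \<sigma> = acost a \<sigma> + nat_cost (aval (Mem a) \<sigma>)"
    by simp
  moreover have "2 * asize (Mem a) * M ^ asize (Mem a) =
    2 * asize a * M ^ asize (Mem a) + 2 * M ^ asize (Mem a)"
    by (simp add: algebra_simps)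
  ultimately show ?case by linarith
next
  case (Bin f a b)
  let ?e = "Bin f a b"
  have "nat_cost (aval ?e \<sigma>) \<le> M ^ asize ?e + 1"
    using nat_cost_le[of "aval ?e \<sigma>"] aval_le[OF assms(1) Bin.prems assms(3)] by simp
  moreover have "1 \<le> M ^ asize ?e"
    using assms(3) by simp
  moreover have "2 * asize a * M ^ asize a \<le> 2 * asize a * M ^ asize ?e"
    "2 * asize b * M ^ asize b \<le> 2 * asize b * M ^ asize ?e"
    using assms(3) by (intro mult_left_mono power_increasing; simp)+
  moreover have "acost a \<sigma> \<le> 2 * asize a * M ^ asize a" "acost b \<sigma> \<le> 2 * asize b * M ^ asize b"
    using Bin by auto
  moreover have "acost ?e \<sigma> = acost a \<sigma> + acost b \<sigma> + nat_cost (aval ?e \<sigma>)"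
    by simp
  moreover have "2 * asize ?e * M ^ asize ?e =
    2 * asize a * M ^ asize ?e + 2 * asize b * M ^ asize ?e + 2 * M ^ asize ?e"
    by (simp add: algebra_simps)
  ultimately show ?case by linarith
qed

text \<open>The largest expression in use, \<open>filtered_exp\<close>, has size 39. Constants may
  depend on \<open>K\<close>; they are bounded by \<open>M\<close>.\<close>

definition small_exp :: "nat \<Rightarrow> aexp \<Rightarrow> bool" where
  "small_exp M e \<longleftrightarrow> asize e \<le> 40 \<and> consts_le M e"

lemma acost_le_small:
  assumes "bounded_state M \<sigma>" "small_exp M e" "2 \<le> M"
  shows "acost e \<sigma> \<le> 80 * M ^ 40"
proof -
  have "acost e \<sigma> \<le> 2 * asize e * M ^ asize e"
    using assms by (intro acost_le) (auto simp: small_exp_def)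
  also have "\<dots> \<le> 80 * M ^ 40"
    using assms by (intro mult_mono power_increasing) (auto simp: small_exp_def)
  finally show ?thesis .
qed

definition runs :: "com \<Rightarrow> state \<Rightarrow> nat \<Rightarrow> state \<Rightarrow> bool" where
  "runs c \<sigma> T \<tau> \<longleftrightarrow> (\<exists>t\<le>T. exec c \<sigma> t \<tau>)"

text \<open>Of this, \<open>80 * M ^ 40\<close> pays for an expression; the rest covers the constant
  overhead and the address register of a store.\<close>

definition step_cost :: "nat \<Rightarrow> nat" where
  "step_cost M = 100 * M ^ 40"

lemma step_cost_bound:
  assumes "bounded_state M \<sigma>" "small_exp M e" "2 \<le> M"
  shows "acost e \<sigma> + 19 \<le> step_cost M"
proof -
  have "1 \<le> M ^ 40" using assms(3) by simp
  then show ?thesis using acost_le_small[OF assms] unfolding step_cost_def by linarith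
qed

lemma runs_mono: "runs c \<sigma> T \<tau> \<Longrightarrow> T \<le> T' \<Longrightarrow> runs c \<sigma> T' \<tau>"
  unfolding runs_def by (meson order_trans)

lemma runs_Seq: "runs c \<sigma> T \<rho> \<Longrightarrow> runs c' \<rho> T' \<tau> \<Longrightarrow> runs (Seq c c') \<sigma> (T + T') \<tau>"
  unfolding runs_def by (meson add_mono exec.Seq)

lemma runs_Assign:
  assumes "bounded_state M \<sigma>" "small_exp M e" "2 \<le> M"
  shows "runs (Assign r e) \<sigma> (step_cost M) ((fst \<sigma>)(r := aval e \<sigma>), snd \<sigma>)"
  unfolding runs_def using step_cost_bound[OF assms]
  by (intro exI[of _ "acost e \<sigma> + 1"] conjI exec.Assign) simp

lemma runs_Store_Reg:
  assumes "bounded_state M \<sigma>" "small_exp M e" "2 \<le> M"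
  shows "runs (Store (Reg r) e) \<sigma> (step_cost M) (fst \<sigma>, (snd \<sigma>)(fst \<sigma> r := aval e \<sigma>))"
proof -
  have "M \<le> M ^ 40" using assms(3) power_increasing[of 1 40 M] by simp
  moreover have "acost (Reg r) \<sigma> \<le> M + 1"
    using nat_cost_le[of "fst \<sigma> r"] assms(1) by (auto simp: bounded_state_def intro: order_trans)
  ultimately have "acost (Reg r) \<sigma> + acost e \<sigma> + 1 \<le> step_cost M"
    using acost_le_small[OF assms] assms(3) unfolding step_cost_def by linarith
  moreover have "exec (Store (Reg r) e) \<sigma> (acost (Reg r) \<sigma> + acost e \<sigma> + 1)
      (fst \<sigma>, (snd \<sigma>)(aval (Reg r) \<sigma> := aval e \<sigma>))"
    by (rule exec.Store)
  ultimately show ?thesis unfolding runs_def by auto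
qed

lemma runs_While_False:
  assumes "aval e \<sigma> = 0" "bounded_state M \<sigma>" "small_exp M e" "2 \<le> M"
  shows "runs (While e c) \<sigma> (step_cost M) \<sigma>"
  unfolding runs_def using step_cost_bound[OF assms(2-4)]
  by (intro exI[of _ "acost e \<sigma> + 1"] conjI exec.WhileFalse assms) simp

lemma runs_While_True:
  assumes "aval e \<sigma> \<noteq> 0" "bounded_state M \<sigma>" "small_exp M e" "2 \<le> M"
    and "runs c \<sigma> T \<rho>" "runs (While e c) \<rho> T' \<tau>"
  shows "runs (While e c) \<sigma> (step_cost M + T + T') \<tau>"
proof -
  obtain t t' where t: "t \<le> T" "exec c \<sigma> t \<rho>" "t' \<le> T'" "exec (While e c) \<rho> t' \<tau>"
    using assms(5,6) unfolding runs_def by blast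
  have "exec (While e c) \<sigma> (acost e \<sigma> + 1 + t + t') \<tau>"
    using assms(1) t(2,4) by (rule exec.WhileTrue)
  then show ?thesis
    unfolding runs_def using step_cost_bound[OF assms(2-4)] t(1,3) by (intro exI conjI) auto
qed

lemma runs_Skip: "2 \<le> M \<Longrightarrow> runs Skip \<sigma> (step_cost M) \<sigma>"
  unfolding runs_def step_cost_def by (intro exI[of _ 1] conjI exec.Skip) (simp add: Suc_leI)

section \<open>The program of the reduction\<close>

abbreviation "r_ptr \<equiv> Reg 0"
abbreviation "r_n \<equiv> Reg 1"
abbreviation "r_d \<equiv> Reg 2"
abbreviation "r_E \<equiv> Reg 3"
abbreviation "r_i \<equiv> Reg 4"

text \<open>
  The output is written from its last cell down to cell 0. In this order every cell of the input is
  overwritten only after it has been read for the last time, and nothing has to be cleaned up.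
\<close>

definition emit :: "aexp \<Rightarrow> com" where
  "emit e = Seq (Assign 0 (Bin Minus r_ptr (Const 1))) (Store r_ptr e)"

fun emit_word :: "nat list \<Rightarrow> com" where
  "emit_word [] = Skip"
| "emit_word (x # xs) = Seq (emit_word xs) (emit (Const x))"

text \<open>The body sees the counter values in decreasing order, so that downward output lists the
  iterations in increasing order.\<close>

definition count_down :: "com \<Rightarrow> com" where
  "count_down body = While r_i (Seq (Assign 4 (Bin Minus r_i (Const 1))) body)"

definition for_down :: "aexp \<Rightarrow> com \<Rightarrow> com" where
  "for_down e body = Seq (Assign 4 e) (count_down body)"

text \<open>Expressions have no conditional; the truth value \<open>c\<close> selects a case by
  multiplication with \<open>c\<close> and \<open>1 - c\<close>.\<close>

definition next_exp :: aexp where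
  "next_exp = (let c = Bin Equal (Bin Modulo (Bin Plus r_i (Const 1)) r_d) (Const 0) in
     Bin Plus (Bin Times c r_E) (Bin Times (Bin Minus (Const 1) c) (Bin Plus r_i (Const 1))))"

definition filtered_exp :: "nat \<Rightarrow> aexp" where
  "filtered_exp K = (let b = Mem (Bin Plus r_i (Const 2)) in
     Bin Plus (Bin Times b (Bin Plus r_E (Const (K + 1)))) (Bin Times (Bin Minus (Const 1) b) next_exp))"

text \<open>The blocks of the encoding from back to front: start edges, coordinate edges, edge
  count, vertices, vertex count. Of each edge the second endpoint is written first.\<close>

definition emit_graph :: "nat \<Rightarrow> aexp \<Rightarrow> com" where
  "emit_graph K e =
     Seq (for_down (Bin Times (Const K) r_n)
       (Seq (emit (Bin Times r_i r_d)) (emit (Bin Plus (Bin Plus r_E (Const 1)) (Bin Divide r_i r_n)))))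
    (Seq (for_down r_E (Seq (emit e) (emit r_i)))
    (Seq (emit (Bin Plus r_E (Bin Times (Const K) r_n)))
    (Seq (for_down (Bin Plus r_E (Const (K + 2))) (emit r_i))
         (emit (Bin Plus r_E (Const (K + 2)))))))"

definition emit_tuple :: "nat \<Rightarrow> aexp \<Rightarrow> com" where
  "emit_tuple K e = Seq (for_down (Const K) (emit e)) (emit (Const K))"

text \<open>The output pointer starts at the total output length: \<open>F + 1\<close> for the
  formula and the number of graphs, \<open>3 * E + 2 * (K * n) + K + 4\<close> for each graph and
  \<open>K + 1\<close> for each tuple.\<close>

definition reduction_setup :: "nat \<Rightarrow> nat \<Rightarrow> com" where
  "reduction_setup K F =
     Seq (Assign 1 (Mem (Const 0)))
    (Seq (Assign 2 (Mem (Const 1)))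
    (Seq (Assign 3 (Bin Times (Bin Times (Const K) r_n) r_d))
         (Assign 0 (Bin Plus (Bin Plus (Bin Times (Const 6) r_E)
             (Bin Times (Const 4) (Bin Times (Const K) r_n))) (Const (F + 4 * K + 11))))))"

text \<open>The filtered graph is the last part that reads bits of the input and is written before
  the plain one, which may overwrite them.\<close>

definition reduction_emit :: "nat \<Rightarrow> nat list \<Rightarrow> com" where
  "reduction_emit K W =
     Seq (emit_tuple K r_E)
    (Seq (emit_tuple K (Bin Plus (Bin Plus r_E (Const 1)) r_i))
    (Seq (emit_graph K (filtered_exp K))
    (Seq (emit_graph K next_exp)
    (Seq (emit (Const 2)) (emit_word W)))))"

text \<open>The pointer and the counter end at 0 by themselves; clearing the other registers leaves
  exactly an initial state, on which a second program can be started.\<close>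

definition reduction_cleanup :: com where
  "reduction_cleanup = Seq (Assign 1 (Const 0)) (Seq (Assign 2 (Const 0)) (Assign 3 (Const 0)))"

definition reduction :: "nat \<Rightarrow> nat list \<Rightarrow> com" where
  "reduction K W = Seq (reduction_setup K (length W)) (Seq (reduction_emit K W) reduction_cleanup)"

section \<open>Correctness and running time of the program\<close>

locale ov_program = ov_graph K n d "\<lambda>q. 0 < w ! q" for K n d :: nat and w :: "nat list" +
  fixes W :: "nat list"
  assumes w: "set w \<subseteq> {0, 1}" "length w = K * n * d" and W: "set W \<subseteq> {..3}"
begin

text \<open>The length of the output, which also bounds every number held in a register or cell
  during the run.\<close>

definition "L = 6 * E + 4 * (K * n) + (length W + 4 * K + 11)"

lemma L_ge: "2 \<le> L" "n \<le> L" "d \<le> L" "E \<le> L" "K * n \<le> L" "E + 2 \<le> L" "E + K + 2 \<le> L"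
  "4 * K + 11 \<le> L" "E + K * n \<le> L" "length W + 4 * K + 11 \<le> L" "E + K + 1 \<le> L"
proof -
  have "1 * n \<le> K * n" using K by (intro mult_right_mono) auto
  then show "n \<le> L" unfolding L_def by linarith
  have "1 * d \<le> K * n * d" using K n by (intro mult_right_mono) (auto simp: Suc_le_eq)
  then show "d \<le> L" unfolding L_def by linarith
qed (simp_all add: L_def)

definition inp :: "nat \<Rightarrow> nat" where
  "inp = snd (init_state (n # d # w))"

lemma inp_le: "inp a \<le> L"
proof (cases "a < 2 + E")
  case True
  have "set (n # d # w) \<subseteq> {..L}"
    using L_ge w by (auto simp: subset_iff)
  moreover have "inp a \<in> set (n # d # w)"
    using True w nth_mem[of a "n # d # w"] by (simp add: inp_def init_state_def del: nth_mem)
  ultimately show ?thesis by blast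
qed (simp add: inp_def init_state_def w)

lemma inp_bit: "q < E \<Longrightarrow> inp (q + 2) = w ! q"
  by (simp add: inp_def init_state_def w)

lemma bit_cases: "q < E \<Longrightarrow> w ! q = 0 \<or> w ! q = 1"
proof -
  assume "q < E"
  then have "w ! q \<in> set w" by (simp add: w)
  with w(1) show ?thesis by blast
qed

definition regs :: "nat \<Rightarrow> nat \<Rightarrow> nat \<Rightarrow> nat" where
  "regs i p = (\<lambda>_. 0)(0 := p, 1 := n, 2 := d, 3 := E, 4 := i)"

definition mem :: "nat \<Rightarrow> nat list \<Rightarrow> nat \<Rightarrow> nat" where
  "mem p ys = (\<lambda>a. if a < p then inp a else if a - p < length ys then ys ! (a - p) else 0)"

lemma regs_simps [simp]:
  "regs i p 0 = p" "regs i p (Suc 0) = n" "regs i p 2 = d" "regs i p 3 = E" "regs i p 4 = i"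
  by (simp_all add: regs_def)

lemma regs_upd: "(regs i p)(0 := p') = regs i p'" "(regs i p)(4 := i') = regs i' p"
  by (auto simp: regs_def)

lemma regs_le: "i \<le> L \<Longrightarrow> p \<le> L \<Longrightarrow> regs i p r \<le> L"
  using L_ge by (auto simp: regs_def)

lemma mem_le: "set ys \<subseteq> {..L} \<Longrightarrow> mem p ys a \<le> L"
  using nth_mem[of "a - p" ys] unfolding mem_def by (simp add: inp_le subset_iff del: nth_mem)

lemma mem_Cons: "(mem (Suc p) ys)(p := z) = mem p (z # ys)"
proof
  fix a
  consider "a < p" | "a = p" | "p < a" by linarith
  then show "((mem (Suc p) ys)(p := z)) a = mem p (z # ys) a"
  proof cases
    case 3
    then have "a - p = Suc (a - Suc p)" by simp
    then show ?thesis using 3 by (simp add: mem_def)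
  qed (simp_all add: mem_def)
qed

abbreviation "st i p ys \<equiv> (regs i p, mem p ys)"

abbreviation "\<kappa> \<equiv> step_cost L"

lemma bounded_regs_mem:
  "i \<le> L \<Longrightarrow> p \<le> L \<Longrightarrow> set ys \<subseteq> {..L} \<Longrightarrow> bounded_state L (regs i p, mem p' ys)"
  by (simp add: bounded_state_def regs_le mem_le)

text \<open>
  Here \<open>q\<close> is a lower bound for the final output position, so that the cells below \<open>q\<close> still hold
  the input throughout.
\<close>

definition emits :: "com \<Rightarrow> nat \<Rightarrow> nat \<Rightarrow> nat list \<Rightarrow> nat \<Rightarrow> nat \<Rightarrow> bool" where
  "emits c i i' zs q t \<longleftrightarrow> (\<forall>p ys. q \<le> p \<longrightarrow> p + length zs \<le> L \<longrightarrow> set ys \<subseteq> {..L} \<longrightarrow>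
     set zs \<subseteq> {..L} \<and> runs c (st i (p + length zs) ys) (\<kappa> * t) (st i' p (zs @ ys)))"

text \<open>Output grows downwards, so the program that runs first yields the back part
  \<open>zs\<close>. It stops \<open>length zs'\<close> cells above the final position and may
  therefore rely on the larger bound \<open>q'\<close>.\<close>

lemma emits_Seq:
  assumes "emits c i i' zs q' t" "emits c' i' i'' zs' q t'" "q' \<le> q + length zs'"
  shows "emits (Seq c c') i i'' (zs' @ zs) q (t + t')"
  unfolding emits_def
proof (intro allI impI)
  fix p ys
  assume p: "q \<le> p" "p + length (zs' @ zs) \<le> L" "set ys \<subseteq> {..L}"
  have 1: "set zs \<subseteq> {..L}"
    "runs c (st i (p + length zs' + length zs) ys) (\<kappa> * t) (st i' (p + length zs') (zs @ ys))"
    using assms(1)[unfolded emits_def, rule_format, of "p + length zs'" ys] assms(3) p by auto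
  moreover have "set zs' \<subseteq> {..L}"
    "runs c' (st i' (p + length zs') (zs @ ys)) (\<kappa> * t') (st i'' p (zs' @ zs @ ys))"
    using assms(2) p 1(1) unfolding emits_def by auto
  ultimately show "set (zs' @ zs) \<subseteq> {..L} \<and>
      runs (Seq c c') (st i (p + length (zs' @ zs)) ys) (\<kappa> * (t + t')) (st i'' p ((zs' @ zs) @ ys))"
    by (auto simp: distrib_left add.assoc intro: runs_Seq)
qed

lemma emits_emit:
  assumes "small_exp L e" "i \<le> L" "z \<le> L"
    and "\<And>p m. q \<le> p \<Longrightarrow> (\<And>a. a < p \<Longrightarrow> m a = inp a) \<Longrightarrow> aval e (regs i p, m) = z"
  shows "emits (emit e) i i [z] q 2"
  unfolding emits_def
proof (intro allI impI conjI)
  fix p ys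
  assume p: "q \<le> p" "p + length [z] \<le> L" "set ys \<subseteq> {..L}"
  have "runs (Assign 0 (Bin Minus r_ptr (Const 1))) (st i (Suc p) ys) \<kappa>
      ((regs i (Suc p))(0 := p), mem (Suc p) ys)"
    using runs_Assign[of L "st i (Suc p) ys" "Bin Minus r_ptr (Const 1)" 0] p L_ge assms
    by (simp add: bounded_regs_mem small_exp_def)
  moreover have "runs (Store r_ptr e) (regs i p, mem (Suc p) ys) \<kappa>
      (regs i p, (mem (Suc p) ys)(p := z))"
  proof -
    have "aval e (regs i p, mem (Suc p) ys) = z"
      using p by (intro assms(4)) (simp_all add: mem_def)
    moreover have "bounded_state L (regs i p, mem (Suc p) ys)"
      using p assms(2) by (intro bounded_regs_mem) auto
    ultimately show ?thesis
      using runs_Store_Reg[of L "(regs i p, mem (Suc p) ys)" e 0] assms(1) L_ge(1) by simp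
  qed
  ultimately have "runs (emit e) (st i (Suc p) ys) (\<kappa> + \<kappa>) (st i p (z # ys))"
    unfolding emit_def regs_upd mem_Cons by (rule runs_Seq)
  then show "runs (emit e) (st i (p + length [z]) ys) (\<kappa> * 2) (st i p ([z] @ ys))"
    by (simp add: mult_2_right)
qed (use assms in auto)

lemma emits_word:
  assumes "i \<le> L" "set xs \<subseteq> {..3}"
  shows "emits (emit_word xs) i i xs q (2 * length xs + 1)"
  using assms(2)
proof (induction xs)
  case Nil
  then show ?case
    unfolding emits_def using runs_Skip[of L] L_ge by simp
next
  case (Cons x xs)
  have "emits (Seq (emit_word xs) (emit (Const x))) i i ([x] @ xs) q (2 * length xs + 1 + 2)"
    by (rule emits_Seq[OF Cons.IH emits_emit]) (use assms Cons.prems L_ge in \<open>auto simp: small_exp_def\<close>)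
  then show ?case by simp
qed

text \<open>An iteration pays \<open>t\<close> for the body and 2 for test and decrement; the final
  failing test is the additional 1.\<close>

lemma emits_count_down:
  assumes "\<And>j. j < b \<Longrightarrow> emits body j j (f j) q t" "b \<le> L"
  shows "emits (count_down body) b 0 (concat (map f [0..<b])) q (b * (t + 2) + 1)"
  using assms
proof (induction b)
  case 0
  have "runs (count_down body) (st 0 p ys) \<kappa> (st 0 p ys)" if "p \<le> L" "set ys \<subseteq> {..L}" for p ys
    unfolding count_down_def using that L_ge
    by (intro runs_While_False bounded_regs_mem) (auto simp: small_exp_def)
  then show ?case by (simp add: emits_def)
next
  case (Suc b)
  let ?zs = "concat (map f [0..<b])"
  show ?case
    unfolding emits_def
  proof (intro allI impI)
    fix p ys
    assume p: "q \<le> p" "p + length (concat (map f [0..<Suc b])) \<le> L" "set ys \<subseteq> {..L}"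
    let ?p = "p + length ?zs + length (f b)"
    have body: "set (f b) \<subseteq> {..L}"
      "runs body (st b ?p ys) (\<kappa> * t) (st b (p + length ?zs) (f b @ ys))"
      using Suc.prems(1)[of b] p unfolding emits_def by auto
    have IH: "set ?zs \<subseteq> {..L}" "runs (count_down body) (st b (p + length ?zs) (f b @ ys))
        (\<kappa> * (b * (t + 2) + 1)) (st 0 p (?zs @ f b @ ys))"
      using Suc.IH Suc.prems p body(1) unfolding emits_def by auto
    have bd: "bounded_state L (st (Suc b) ?p ys)"
      using p Suc.prems by (intro bounded_regs_mem) auto
    have "runs (Assign 4 (Bin Minus r_i (Const 1))) (st (Suc b) ?p ys) \<kappa>
        ((regs (Suc b) ?p)(4 := b), mem ?p ys)"
      using runs_Assign[OF bd, of "Bin Minus r_i (Const 1)" 4] L_ge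
      by (simp add: small_exp_def)
    then have "runs (Seq (Assign 4 (Bin Minus r_i (Const 1))) body) (st (Suc b) ?p ys) (\<kappa> + \<kappa> * t)
        (st b (p + length ?zs) (f b @ ys))"
      unfolding regs_upd using body(2) by (rule runs_Seq)
    then have run: "runs (count_down body) (st (Suc b) ?p ys) (\<kappa> + (\<kappa> + \<kappa> * t) + \<kappa> * (b * (t + 2) + 1))
        (st 0 p (?zs @ f b @ ys))"
      unfolding count_down_def
      using IH(2)[unfolded count_down_def] bd L_ge
      by (intro runs_While_True) (auto simp: small_exp_def)
    have eq: "\<kappa> + (\<kappa> + \<kappa> * t) + \<kappa> * (b * (t + 2) + 1) = \<kappa> * (Suc b * (t + 2) + 1)"
      by (simp add: algebra_simps)
    show "set (concat (map f [0..<Suc b])) \<subseteq> {..L} \<and>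
        runs (count_down body) (st (Suc b) (p + length (concat (map f [0..<Suc b]))) ys)
          (\<kappa> * (Suc b * (t + 2) + 1)) (st 0 p (concat (map f [0..<Suc b]) @ ys))"
      using body(1) IH(1) run[unfolded eq] by (simp add: add.assoc)
  qed
qed

lemma emits_for_down:
  assumes "small_exp L e" "i \<le> L" "b \<le> L" "\<And>p m. aval e (regs i p, m) = b"
    and "\<And>j. j < b \<Longrightarrow> emits body j j (f j) q t"
  shows "emits (for_down e body) i 0 (concat (map f [0..<b])) q (b * (t + 2) + 2)"
  unfolding emits_def
proof (intro allI impI)
  fix p ys
  let ?zs = "concat (map f [0..<b])"
  assume p: "q \<le> p" "p + length ?zs \<le> L" "set ys \<subseteq> {..L}"
  have "runs (Assign 4 e) (st i (p + length ?zs) ys) \<kappa>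
      ((regs i (p + length ?zs))(4 := b), mem (p + length ?zs) ys)"
    using runs_Assign[of L "st i (p + length ?zs) ys" e 4] p L_ge assms(1-4)
    by (simp add: bounded_regs_mem)
  moreover have "set ?zs \<subseteq> {..L}" "runs (count_down body) (st b (p + length ?zs) ys)
      (\<kappa> * (b * (t + 2) + 1)) (st 0 p (?zs @ ys))"
    using emits_count_down[OF assms(5,3)] p unfolding emits_def by auto
  ultimately have "runs (for_down e body) (st i (p + length ?zs) ys) (\<kappa> + \<kappa> * (b * (t + 2) + 1))
      (st 0 p (?zs @ ys))"
    unfolding for_down_def regs_upd by (intro runs_Seq)
  then show "set ?zs \<subseteq> {..L} \<and> runs (for_down e body) (st i (p + length ?zs) ys)
      (\<kappa> * (b * (t + 2) + 2)) (st 0 p (?zs @ ys))"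
    using \<open>set ?zs \<subseteq> {..L}\<close> by (simp add: algebra_simps)
qed

lemma emits_graph:
  assumes e: "small_exp L e" "\<And>j p m. j < E \<Longrightarrow> q \<le> p \<Longrightarrow> (\<And>a. a < p \<Longrightarrow> m a = inp a) \<Longrightarrow>
      aval e (regs j p, m) = f j"
    and f: "\<And>j. j < E \<Longrightarrow> f j \<le> L"
  shows "emits (emit_graph K e) 0 0 (encode_input_graph (ov_input f)) q
    (6 * (K * n) + 6 * E + 4 * (E + K + 2) + 10)"
proof -
  let ?m = "E + K * n" and ?V = "E + K + 2"
  have starts: "emits (Seq (emit (Bin Times r_i r_d))
      (emit (Bin Plus (Bin Plus r_E (Const 1)) (Bin Divide r_i r_n)))) j j
      ([E + 1 + j div n] @ [j * d]) q (2 + 2)" if j: "j < K * n" for j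
  proof (rule emits_Seq; (rule emits_emit)?)
    have "j * d < E" using pos_less[OF j, of 0] d by simp
    then show "j * d \<le> L" using L_ge by linarith
    show "E + 1 + j div n \<le> L"
      using less_mult_imp_div_less[OF j] L_ge by linarith
    show "j \<le> L" "j \<le> L" using j L_ge by linarith+
  qed (use L_ge in \<open>auto simp: small_exp_def\<close>)
  have edges: "emits (Seq (emit e) (emit r_i)) j j ([j] @ [f j]) q (2 + 2)" if "j < E" for j
    by (rule emits_Seq; (rule emits_emit)?) (use that e f L_ge in \<open>auto simp: small_exp_def\<close>)
  have verts: "emits (emit r_i) j j [j] q 2" if "j < ?V" for j
    by (rule emits_emit) (use that L_ge in \<open>auto simp: small_exp_def\<close>)
  have main: "emits (emit_graph K e) 0 0
    (((([?V] @ concat (map (\<lambda>j. [j]) [0..<?V])) @ [?m]) @ concat (map (\<lambda>j. [j] @ [f j]) [0..<E])) @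
      concat (map (\<lambda>j. [E + 1 + j div n] @ [j * d]) [0..<K * n])) q
    ((K * n * (2 + 2 + 2) + 2) + ((E * (2 + 2 + 2) + 2) + (2 + ((?V * (2 + 2) + 2) + 2))))"
    unfolding emit_graph_def
    by (intro emits_Seq[OF emits_for_down[OF _ _ _ _ starts]]
          emits_Seq[OF emits_for_down[OF _ _ _ _ edges]] emits_Seq[OF emits_emit]
          emits_Seq[OF emits_for_down[OF _ _ _ _ verts] emits_emit])
       (use L_ge in \<open>auto simp: small_exp_def\<close>)
  have singletons: "concat (map (\<lambda>j. [j]) xs) = xs" for xs :: "nat list"
    by (induction xs) auto
  have enc: "encode_input_graph (ov_input f) = [?V] @ [0..<?V] @ [?m] @
      concat (map (\<lambda>j. [j, f j]) [0..<E]) @ concat (map (\<lambda>j. [E + 1 + j div n, j * d]) [0..<K * n])"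
    by (simp add: encode_input_graph_def encode_tuple_def ov_input_def ov_edges_def comp_def
        del: upt_Suc)
  have time: "(K * n * (2 + 2 + 2) + 2) + ((E * (2 + 2 + 2) + 2) + (2 + ((?V * (2 + 2) + 2) + 2)))
      = 6 * (K * n) + 6 * E + 4 * (E + K + 2) + 10"
    by simp
  show ?thesis
    using main unfolding time singletons enc by (simp only: append.assoc append_Cons append_Nil)
qed

lemma emits_tuple:
  assumes "small_exp L e" "\<And>j p m. j < K \<Longrightarrow> aval e (regs j p, m) = f j" "\<And>j. j < K \<Longrightarrow> f j \<le> L"
  shows "emits (emit_tuple K e) 0 0 (encode_tuple (map f [0..<K])) q (4 * K + 4)"
proof -
  have "emits (emit e) j j [f j] q 2" if "j < K" for j
    by (rule emits_emit) (use that assms L_ge in auto)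
  then have *: "emits (emit_tuple K e) 0 0 ([K] @ concat (map (\<lambda>j. [f j]) [0..<K])) q
      ((K * (2 + 2) + 2) + 2)"
    unfolding emit_tuple_def
    by (intro emits_Seq[OF emits_for_down emits_emit]) (use L_ge in \<open>auto simp: small_exp_def\<close>)
  have "concat (map (\<lambda>j. [f j]) xs) = map f xs" for xs
    by (induction xs) auto
  moreover have "(K * (2 + 2) + 2) + 2 = 4 * K + 4"
    by simp
  ultimately show ?thesis using * by (simp only: encode_tuple_def) simp
qed

lemma length_encode_ov_input:
  "length (encode_input_graph (ov_input f)) = 2 + (E + K + 2) + 2 * (E + K * n)"
proof -
  have "length (concat (map (\<lambda>(u, v). [u, v]) xs)) = 2 * length xs" for xs :: "(nat \<times> nat) list"
    by (induction xs) auto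
  then show ?thesis
    unfolding encode_input_graph_def encode_tuple_def ov_input_def
    by (simp add: ov_edges_def del: upt_Suc map_map map_append concat_append)
qed

lemma next_exp_val: "j < E \<Longrightarrow> aval next_exp (regs j p, m) = next_pos j"
  by (simp add: next_exp_def next_pos_def Let_def)

text \<open>The bit of position \<open>j\<close> is in cell \<open>j + 2\<close>, behind
  \<open>n\<close> and \<open>d\<close>, so all bits are intact while the output stays at or above
  cell \<open>E + 2\<close>. Being 0 or 1, the bit can act as a selector.\<close>

lemma filtered_exp_val:
  assumes "j < E" "E + 2 \<le> p" "\<And>a. a < p \<Longrightarrow> m a = inp a"
  shows "aval (filtered_exp K) (regs j p', m) = filtered_pos j"
proof -
  have "m (j + 2) = w ! j"
    using assms inp_bit[of j] by simp
  then show ?thesis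
    using bit_cases[OF assms(1)] next_exp_val[OF assms(1)]
    unfolding filtered_pos_def by (auto simp: filtered_exp_def Let_def)
qed

definition out_word :: "nat list" where
  "out_word = W @ 2 # encode_input_graph (ov_input next_pos) @
     encode_input_graph (ov_input filtered_pos) @ encode_tuple ov_start @ encode_tuple ov_end"

text \<open>Started at \<open>L\<close>, the downward output thus ends exactly at cell 0.\<close>

lemma length_out_word: "length out_word = L"
  by (simp add: out_word_def length_encode_ov_input encode_tuple_def ov_start_def ov_end_def L_def
      del: upt_Suc)

lemma emits_reduction:
  "emits (reduction_emit K W) 0 0 out_word 0 (10 * L)"
proof -
  let ?T = "6 * (K * n) + 6 * E + 4 * (E + K + 2) + 10"
  have t: "emits (emit_tuple K r_E) 0 0 (encode_tuple (map (\<lambda>_. E) [0..<K])) (E + 2) (4 * K + 4)"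
    by (rule emits_tuple) (use L_ge in \<open>auto simp: small_exp_def\<close>)
  have s: "emits (emit_tuple K (Bin Plus (Bin Plus r_E (Const 1)) r_i)) 0 0
      (encode_tuple (map (\<lambda>j. E + 1 + j) [0..<K])) (E + 2) (4 * K + 4)"
    by (rule emits_tuple) (use L_ge in \<open>auto simp: small_exp_def\<close>)
  have H: "emits (emit_graph K (filtered_exp K)) 0 0 (encode_input_graph (ov_input filtered_pos))
      (E + 2) ?T"
  proof (rule emits_graph)
    show "small_exp L (filtered_exp K)"
      using L_ge by (simp add: small_exp_def filtered_exp_def next_exp_def Let_def)
    show "filtered_pos j \<le> L" if "j < E" for j
      using filtered_pos_le[OF that] L_ge by linarith
  qed (rule filtered_exp_val)
  have G: "emits (emit_graph K next_exp) 0 0 (encode_input_graph (ov_input next_pos)) 0 ?T"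
  proof (rule emits_graph)
    show "small_exp L next_exp"
      using L_ge by (simp add: small_exp_def next_exp_def Let_def)
    show "next_pos j \<le> L" if "j < E" for j
      using next_pos_le[OF that] L_ge by linarith
  qed (rule next_exp_val)
  have two: "emits (emit (Const 2)) 0 0 [2] 0 2"
    by (rule emits_emit) (use L_ge in \<open>auto simp: small_exp_def\<close>)
  have word: "emits (emit_word W) 0 0 W 0 (2 * length W + 1)"
    by (rule emits_word) (use W in auto)
  \<comment> \<open>The plain graph alone takes more than \<open>E + 2\<close> cells, so everything
    written before it stays above the input bits.\<close>
  have "emits (reduction_emit K W) 0 0 (((((W @ [2]) @ encode_input_graph (ov_input next_pos)) @
      encode_input_graph (ov_input filtered_pos)) @ encode_tuple (map (\<lambda>j. E + 1 + j) [0..<K])) @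
      encode_tuple (map (\<lambda>_. E) [0..<K])) 0
      ((4 * K + 4) + ((4 * K + 4) + (?T + (?T + (2 + (2 * length W + 1))))))"
    unfolding reduction_emit_def
    by (rule emits_Seq[OF t emits_Seq[OF s emits_Seq[OF H emits_Seq[OF G emits_Seq[OF two word]]]]])
       (simp_all add: length_encode_ov_input)
  moreover have "(4 * K + 4) + ((4 * K + 4) + (?T + (?T + (2 + (2 * length W + 1))))) \<le> 10 * L"
    unfolding L_def by simp
  moreover have "emits c i i' zs q t'" if "emits c i i' zs q t" "t \<le> t'" for c i i' zs q t t'
    using that unfolding emits_def by (meson mult_le_mono2 runs_mono)
  ultimately show ?thesis
    by (simp add: out_word_def ov_start_def ov_end_def map_replicate_const del: upt_Suc)
qed

lemma runs_setup:
  "runs (reduction_setup K (length W)) (init_state (n # d # w)) (\<kappa> * 4) (st 0 L [])"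
proof -
  have inp: "inp 0 = n" "inp (Suc 0) = d"
    by (simp_all add: inp_def init_state_def)
  have bounded: "bounded_state L (\<rho>, inp)" if "\<forall>r. \<rho> r \<le> L" for \<rho>
    using that inp_le by (simp add: bounded_state_def)
  let ?r0 = "\<lambda>_. 0" let ?r1 = "?r0(1 := n)" let ?r2 = "?r1(2 := d)" let ?r3 = "?r2(3 := E)"
  have init: "init_state (n # d # w) = (?r0, inp)"
    by (simp add: inp_def init_state_def)
  have "runs (Assign 1 (Mem (Const 0))) (?r0, inp) \<kappa> (?r1, inp)"
    using runs_Assign[of L "(?r0, inp)" "Mem (Const 0)" 1] bounded[of ?r0] L_ge inp
    by (simp add: small_exp_def)
  moreover have "runs (Assign 2 (Mem (Const 1))) (?r1, inp) \<kappa> (?r2, inp)"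
    using runs_Assign[of L "(?r1, inp)" "Mem (Const 1)" 2] bounded[of ?r1] L_ge inp
    by (simp add: small_exp_def)
  moreover have "runs (Assign 3 (Bin Times (Bin Times (Const K) r_n) r_d)) (?r2, inp) \<kappa> (?r3, inp)"
    using runs_Assign[of L "(?r2, inp)" "Bin Times (Bin Times (Const K) r_n) r_d" 3]
      bounded[of ?r2] L_ge
    by (simp add: small_exp_def)
  moreover have "runs (Assign 0 (Bin Plus (Bin Plus (Bin Times (Const 6) r_E)
      (Bin Times (Const 4) (Bin Times (Const K) r_n))) (Const (length W + 4 * K + 11))))
      (?r3, inp) \<kappa> (?r3(0 := L), inp)"
    using runs_Assign[of L "(?r3, inp)" "Bin Plus (Bin Plus (Bin Times (Const 6) r_E)
      (Bin Times (Const 4) (Bin Times (Const K) r_n))) (Const (length W + 4 * K + 11))" 0]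
      bounded[of ?r3] L_ge
    by (simp add: small_exp_def L_def)
  ultimately have run: "runs (reduction_setup K (length W)) (?r0, inp) (\<kappa> + (\<kappa> + (\<kappa> + \<kappa>))) (?r3(0 := L), inp)"
    unfolding reduction_setup_def by (intro runs_Seq)
  have regs: "?r3(0 := L) = regs 0 L"
    by (auto simp: regs_def)
  \<comment> \<open>The input occupies \<open>E + 2 \<le> L\<close> cells, so all cells from
    \<open>L\<close> on are 0.\<close>
  have mem: "inp = mem L []"
  proof
    fix a show "inp a = mem L [] a"
      using L_ge w by (simp add: mem_def inp_def init_state_def)
  qed
  have time: "\<kappa> + (\<kappa> + (\<kappa> + \<kappa>)) = \<kappa> * 4"
    by simp
  show ?thesis
    using run unfolding init regs time mem[symmetric] .
qed

lemma runs_cleanup: "runs reduction_cleanup (st 0 0 out_word) (\<kappa> * 3) (init_state out_word)"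
proof -
  have "set out_word \<subseteq> {..L}"
    using emits_reduction[unfolded emits_def, rule_format, of 0 "[]"] length_out_word by simp
  then have bounded: "bounded_state L (\<rho>, mem 0 out_word)" if "\<forall>r. \<rho> r \<le> L" for \<rho>
    using that mem_le by (simp add: bounded_state_def)
  have clear: "runs (Assign r (Const 0)) (\<rho>, mem 0 out_word) \<kappa> (\<rho>(r := 0), mem 0 out_word)"
    if "\<forall>r. \<rho> r \<le> L" for r \<rho>
    using runs_Assign[of L "(\<rho>, mem 0 out_word)" "Const 0" r] bounded[OF that] L_ge
    by (simp add: small_exp_def)
  have "runs reduction_cleanup (st 0 0 out_word) (\<kappa> + (\<kappa> + \<kappa>))
      ((regs 0 0)(1 := 0, 2 := 0, 3 := 0), mem 0 out_word)"
    unfolding reduction_cleanup_def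
    by (rule runs_Seq[OF clear runs_Seq[OF clear clear]]) (simp_all add: regs_le)
  moreover have "(regs 0 0)(1 := 0, 2 := 0, 3 := 0) = (\<lambda>_. 0)"
    by (auto simp: regs_def)
  moreover have "mem 0 out_word = snd (init_state out_word)"
    by (auto simp: mem_def init_state_def)
  moreover have "\<kappa> + (\<kappa> + \<kappa>) = \<kappa> * 3"
    by simp
  ultimately show ?thesis
    by (simp add: init_state_def)
qed

text \<open>At most \<open>20 * L\<close> elementary steps of cost \<open>100 * L ^ 40\<close> each;
  hence the exponent 41, independent of \<open>K\<close>.\<close>

lemma runs_reduction:
  "runs (reduction K W) (init_state (n # d # w)) (2000 * L ^ 41) (init_state out_word)"
proof -
  have "runs (reduction_emit K W) (st 0 L []) (\<kappa> * (10 * L)) (st 0 0 out_word)"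
    using emits_reduction[unfolded emits_def, rule_format, of 0 "[]"] length_out_word by simp
  then have run: "runs (reduction K W) (init_state (n # d # w)) (\<kappa> * 4 + (\<kappa> * (10 * L) + \<kappa> * 3))
      (init_state out_word)"
    unfolding reduction_def by (rule runs_Seq[OF runs_setup runs_Seq[OF _ runs_cleanup]])
  have le: "\<kappa> * 4 + (\<kappa> * (10 * L) + \<kappa> * 3) \<le> \<kappa> * (20 * L)"
  proof -
    have "\<kappa> * 4 + (\<kappa> * (10 * L) + \<kappa> * 3) = \<kappa> * (10 * L + 7)"
      by (simp add: algebra_simps)
    also have "\<dots> \<le> \<kappa> * (20 * L)"
      using L_ge by (intro mult_left_mono) auto
    finally show ?thesis .
  qed
  have eq: "\<kappa> * (20 * L) = 2000 * L ^ 41"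
    by (simp add: step_cost_def power_Suc2[of L 40, symmetric] del: power_Suc2)
  show ?thesis
    using runs_mono[OF run le] unfolding eq .
qed

end

section \<open>The lower bound\<close>

lemma set_encode_formula: "inputs f \<subseteq> {..3} \<Longrightarrow> set (encode_formula f) \<subseteq> {..3}"
  by (induction f) auto

lemma (in ov_program) reach_encode_ov_instance:
  "encode_formula (ov_formula K r) = W \<Longrightarrow> reach_encode (ov_instance r) = out_word"
  by (simp add: ov_instance_def out_word_def)

text \<open>The program depends on \<open>K\<close> and \<open>r\<close> only, so a single one
  serves all \<open>n\<close>, \<open>d\<close> and \<open>A\<close>.\<close>

lemma kOV_reduction:
  fixes K n d r :: nat
  assumes inst: "kOV_instance K n d A" and K: "K \<ge> 2"
  defines "W \<equiv> encode_formula (ov_formula K r)"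
  shows "\<exists>x. reach_instance (K * n * d + K + 2) (K\<^sup>2 + r) x \<and> (reach_answer x \<longleftrightarrow> kOV K d A) \<and>
    runs (reduction K W) (init_state (kOV_encode n d A))
      (2000 * (6 * (K * n * d) + 4 * (K * n) + (length W + 4 * K + 11)) ^ 41) (init_state (reach_encode x))"
proof -
  define w where "w = concat (map concat A)"
  have A: "n \<ge> 1" "d \<ge> 1" "length A = K" "\<And>S. S \<in> set A \<Longrightarrow> length S = n"
    "\<And>S v. S \<in> set A \<Longrightarrow> v \<in> set S \<Longrightarrow> length v = d"
    "\<And>S v. S \<in> set A \<Longrightarrow> v \<in> set S \<Longrightarrow> set v \<subseteq> {0, 1}"
    using inst unfolding kOV_instance_def by auto
  have "set w \<subseteq> {0, 1}"
    using A(6) by (fastforce simp: w_def)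
  moreover have "length w = K * n * d"
    unfolding w_def
    by (subst length_concat_uniform[where m = "n * d"]) (auto simp: A length_concat_uniform[of _ d])
  moreover have "set W \<subseteq> {..3}"
    unfolding W_def using K by (intro set_encode_formula) (simp add: inputs_ov_formula)
  ultimately interpret ov_program K n d w W
    using K A by unfold_locales
  have "reach_answer (ov_instance r) \<longleftrightarrow> kOV K d A"
    using reach_answer_ov[of r] kOV_iff_positions[OF inst K] unfolding w_def by simp
  moreover have "reach_encode (ov_instance r) = out_word"
    by (rule reach_encode_ov_instance) (simp add: W_def)
  moreover have "kOV_encode n d A = n # d # w"
    by (simp add: kOV_encode_def w_def)
  ultimately show ?thesis
    using reach_instance_ov[of r] runs_reduction unfolding L_def
    by (intro exI[of _ "ov_instance r"]) metis
qed

text \<open>Running the reduction and then \<open>P\<close> would solve kOV for \<open>K\<close>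
  sets with a saving of \<open>\<epsilon> = 1\<close>: the instance has \<open>N = O(n * d)\<close>
  vertices for fixed \<open>K\<close>, so \<open>P\<close> takes
  \<open>O((n * d) ^ (K - 1))\<close>, and the exponent 41 of the reduction is below
  \<open>K - 1\<close>.\<close>

lemma reach_hard:
  fixes K r :: nat and e :: real
  assumes conj: "kOV_conjecture" and K: "K \<ge> 43" and e: "0 \<le> e" "e \<le> real K - 1"
  shows "\<not> (\<exists>P B. \<forall>n x. n \<ge> 1 \<longrightarrow> reach_instance n (K\<^sup>2 + r) x \<longrightarrow>
    decides_within P (reach_encode x) (reach_answer x) (B * real n powr e))"
proof
  assume "\<exists>P B. \<forall>n x. n \<ge> 1 \<longrightarrow> reach_instance n (K\<^sup>2 + r) x \<longrightarrow>
    decides_within P (reach_encode x) (reach_answer x) (B * real n powr e)"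
  then obtain P B where P: "\<And>n x. n \<ge> 1 \<Longrightarrow> reach_instance n (K\<^sup>2 + r) x \<Longrightarrow>
    decides_within P (reach_encode x) (reach_answer x) (B * real n powr e)" by blast
  define W where "W = encode_formula (ov_formula K r)"
  \<comment> \<open>Chosen so that both the output length and the vertex count are at most
    \<open>c * (n * d)\<close>; \<open>14 * K\<close> adds up the coefficients 6, 4 and 4 in
    \<open>L\<close>.\<close>
  define c where "c = 14 * K + length W + 11"
  define B' where "B' = 2000 * real c ^ 41 + \<bar>B\<bar> * real c ^ (K - 1)"
  have "decides_within (Seq (reduction K W) P) (kOV_encode n d A) (kOV K d A)
      (B' * (real n powr (real K - 1) * real d ^ K))" if inst: "kOV_instance K n d A" for n d A
  proof -
    have nd: "n \<ge> 1" "d \<ge> 1"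
      using inst by (auto simp: kOV_instance_def)
    define N where "N = K * n * d + K + 2"
    define L where "L = 6 * (K * n * d) + 4 * (K * n) + (length W + 4 * K + 11)"
    obtain x where x: "reach_instance N (K\<^sup>2 + r) x" "reach_answer x \<longleftrightarrow> kOV K d A"
      "runs (reduction K W) (init_state (kOV_encode n d A)) (2000 * L ^ 41) (init_state (reach_encode x))"
      using kOV_reduction[OF inst, of r] K unfolding W_def N_def L_def by auto
    from x(3) obtain t1 where t1: "t1 \<le> 2000 * L ^ 41"
      "exec (reduction K W) (init_state (kOV_encode n d A)) t1 (init_state (reach_encode x))"
      unfolding runs_def by blast
    have "decides_within P (reach_encode x) (reach_answer x) (B * real N powr e)"
      using x(1) by (intro P) (simp_all add: N_def)
    then obtain t2 \<tau> where t2: "exec P (init_state (reach_encode x)) t2 \<tau>"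
      "real t2 \<le> B * real N powr e" "fst \<tau> 0 \<noteq> 0 \<longleftrightarrow> reach_answer x"
      unfolding decides_within_def by blast
    have nd1: "1 \<le> n * d" using nd by (simp add: Suc_le_eq)
    have "n * 1 \<le> n * d" using nd by (intro mult_left_mono) auto
    then have Kn: "K * n \<le> K * (n * d)" by (intro mult_left_mono) auto
    have const: "a \<le> a * (n * d)" for a :: nat
      using nd1 mult_left_mono[of 1 "n * d" a] by simp
    have "c * (n * d) = 10 * (K * (n * d)) + (length W + 4 * K + 11) * (n * d)"
      by (simp add: c_def algebra_simps)
    then have "L \<le> c * (n * d)"
      using Kn const[of "length W + 4 * K + 11"] unfolding L_def mult.assoc by linarith
    then have "L ^ 41 \<le> (c * (n * d)) ^ 41" by (rule power_mono) simp
    also have "\<dots> = c ^ 41 * (n ^ 41 * d ^ 41)" by (simp add: power_mult_distrib)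
    \<comment> \<open>Here the size of \<open>K\<close> enters, through
      \<open>41 \<le> K - 1\<close>.\<close>
    also have "\<dots> \<le> c ^ 41 * (n ^ (K - 1) * d ^ K)"
      using nd K by (intro mult_left_mono mult_mono power_increasing) auto
    finally have "real t1 \<le> real (2000 * (c ^ 41 * (n ^ (K - 1) * d ^ K)))"
      using t1(1) by (intro of_nat_mono) linarith
    then have T1: "real t1 \<le> 2000 * real c ^ 41 * (real n ^ (K - 1) * real d ^ K)"
      by simp
    have "c * (n * d) = K * (n * d) + (K + 2) * (n * d) + (length W + 12 * K + 9) * (n * d)"
      by (simp add: c_def algebra_simps)
    then have N: "N \<le> c * (n * d)"
      using const[of "K + 2"] unfolding N_def mult.assoc by linarith
    have "1 \<le> N" unfolding N_def by simp
    have "real N powr e \<le> real N powr real (K - 1)"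
      using e K \<open>1 \<le> N\<close> by (intro powr_mono) (auto simp: of_nat_diff)
    also have "\<dots> = real (N ^ (K - 1))"
      using \<open>1 \<le> N\<close> by (simp add: powr_realpow)
    also have "N ^ (K - 1) \<le> (c * (n * d)) ^ (K - 1)"
      using N by (rule power_mono) simp
    then have "real (N ^ (K - 1)) \<le> real ((c * (n * d)) ^ (K - 1))"
      by (rule of_nat_mono)
    also have "(c * (n * d)) ^ (K - 1) = c ^ (K - 1) * (n ^ (K - 1) * d ^ (K - 1))"
      by (simp add: power_mult_distrib)
    also have "\<dots> \<le> c ^ (K - 1) * (n ^ (K - 1) * d ^ K)"
      using nd by (intro mult_left_mono power_increasing) auto
    then have "real (c ^ (K - 1) * (n ^ (K - 1) * d ^ (K - 1))) \<le> real (c ^ (K - 1) * (n ^ (K - 1) * d ^ K))"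
      by (rule of_nat_mono)
    finally have "real N powr e \<le> real c ^ (K - 1) * (real n ^ (K - 1) * real d ^ K)"
      by simp
    then have "\<bar>B\<bar> * real N powr e \<le> \<bar>B\<bar> * (real c ^ (K - 1) * (real n ^ (K - 1) * real d ^ K))"
      by (rule mult_left_mono) simp
    moreover have "B * real N powr e \<le> \<bar>B\<bar> * real N powr e"
      by (intro mult_right_mono) auto
    ultimately have "real (t1 + t2) \<le> B' * (real n ^ (K - 1) * real d ^ K)"
      using T1 t2(2) unfolding B'_def by (simp add: algebra_simps)
    moreover have "real n powr (real K - 1) = real n ^ (K - 1)"
      using powr_realpow[of "real n" "K - 1"] nd K by (simp add: of_nat_diff)
    moreover have "exec (Seq (reduction K W) P) (init_state (kOV_encode n d A)) (t1 + t2) \<tau>"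
      using t1(2) t2(1) by (rule exec.Seq)
    ultimately show ?thesis
      unfolding decides_within_def using t2(3) x(2) by (intro exI conjI) auto
  qed
  then have "\<exists>P. \<exists>B::real. \<exists>C::nat. \<forall>n d A. kOV_instance K n d A \<longrightarrow>
      decides_within P (kOV_encode n d A) (kOV K d A) (B * (real n powr (real K - 1) * real d ^ C))"
    by blast
  moreover have "K \<ge> 2" "(1::real) > 0"
    using K by auto
  ultimately show False
    using conj unfolding kOV_conjecture_def by blast
qed

text \<open>The exponent \<open>C\<close> is the same for all \<open>k\<close>, so some
  \<open>K\<close> exceeds it; the instances with \<open>k = K * K\<close> need no padding.\<close>

lemma reach_not_fpt:
  assumes "kOV_conjecture"
  shows "\<not> fixed_parameter_tractable reach_instance reach_encode reach_answer"
proof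
  assume "fixed_parameter_tractable reach_instance reach_encode reach_answer"
  then obtain P and g :: "nat \<Rightarrow> real" and C where P: "\<And>n k x. reach_instance n k x \<Longrightarrow>
      decides_within P (reach_encode x) (reach_answer x) (g k * real n ^ C)"
    unfolding fixed_parameter_tractable_def by blast
  define K where "K = max 43 (C + 1)"
  \<comment> \<open>\<open>n \<ge> 1\<close> permits the passage from the natural power to
    \<open>powr\<close>, which differ at base and exponent 0.\<close>
  have "decides_within P (reach_encode x) (reach_answer x) (g (K\<^sup>2 + 0) * real n powr real C)"
    if "n \<ge> 1" "reach_instance n (K\<^sup>2 + 0) x" for n x
    using P[OF that(2)] that(1) by (simp add: powr_realpow)
  moreover have "43 \<le> K" "0 \<le> real C" "real C \<le> real K - 1"
    by (simp_all add: K_def)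
  ultimately show False
    using reach_hard[OF assms, of K "real C" 0] by blast
qed

text \<open>Take the largest \<open>K\<close> whose square is at most \<open>k\<close> and pad the
  formula to complexity \<open>k\<close>. The excluded exponent \<open>K - 1\<close> is of order
  \<open>sqrt k\<close>, which dominates the cube root.\<close>

lemma reach_lower_bound:
  assumes "kOV_conjecture" and k: "k \<ge> 43\<^sup>2"
  shows "\<not> solvable_in_time reach_instance reach_encode reach_answer k
    (\<lambda>n. real n powr (1 / 2 * real k powr (1 / 3)))"
proof
  let ?e = "1 / 2 * real k powr (1 / 3)"
  assume "solvable_in_time reach_instance reach_encode reach_answer k (\<lambda>n. real n powr ?e)"
  then have P: "\<exists>P B. \<forall>n x. reach_instance n k x \<longrightarrow>
      decides_within P (reach_encode x) (reach_answer x) (B * real n powr ?e)"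
    unfolding solvable_in_time_def .
  define K where "K = floor_sqrt k"
  have K: "43 \<le> K" "K\<^sup>2 \<le> k" "k < (Suc K)\<^sup>2"
    unfolding K_def using le_floor_sqrtI[OF k] floor_sqrt_power2_le Suc_floor_sqrt_power2_gt
    by blast+
  have "real k < real ((Suc K)\<^sup>2)"
    using K(3) by (rule of_nat_less_iff[THEN iffD2])
  then have "real k < (real K + 1)\<^sup>2"
    by (simp add: add.commute)
  then have "sqrt (real k) < real K + 1"
    by (intro real_less_lsqrt) auto
  moreover have "real k powr (1 / 3) \<le> real k powr (1 / 2)"
    using k by (intro powr_mono) auto
  \<comment> \<open>The exponent is below \<open>(K + 1) / 2\<close>, which is at most
    \<open>K - 1\<close> because \<open>K \<ge> 43\<close>.\<close>
  ultimately have "?e \<le> real K - 1"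
    using K(1) by (simp add: powr_half_sqrt)
  then have "\<not> (\<exists>P B. \<forall>n x. n \<ge> 1 \<longrightarrow> reach_instance n (K\<^sup>2 + (k - K\<^sup>2)) x \<longrightarrow>
      decides_within P (reach_encode x) (reach_answer x) (B * real n powr ?e))"
    by (intro reach_hard[OF assms(1) K(1)]) simp
  moreover have "K\<^sup>2 + (k - K\<^sup>2) = k"
    using K(2) by simp
  ultimately show False
    using P by (simp only:) blast
qed

theorem theorem1p3:
  assumes "kOV_conjecture"
  shows "\<not> fixed_parameter_tractable reach_instance reach_encode reach_answer \<and>
    (\<exists>c::real. c > 0 \<and> (\<exists>k\<^sub>0. \<forall>k\<ge>k\<^sub>0.
      \<not> solvable_in_time reach_instance reach_encode reach_answer k
          (\<lambda>n. real n powr (c * real k powr (1/3)))))"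
proof (intro conjI exI[of _ "1/2::real"] exI[of _ "43\<^sup>2::nat"] allI impI)
  show "\<not> fixed_parameter_tractable reach_instance reach_encode reach_answer"
    by (rule reach_not_fpt[OF assms])
  show "\<not> solvable_in_time reach_instance reach_encode reach_answer k
      (\<lambda>n. real n powr (1 / 2 * real k powr (1 / 3)))" if "43\<^sup>2 \<le> k" for k
    by (rule reach_lower_bound[OF assms that])
qed simp

end
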